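(* Let $\mathbb{K}$ be a field and let $\Gamma$ be a finite, connected, simple graph. Then the zigzag algebra $Z(\Gamma)$ over $\mathbb{K}$ is not quasi-hereditary.
   Context: Zigzag algebra. Let $\Gamma$ be a finite, connected, simple graph. Let $Q$ be the double quiver of $\Gamma$: same vertices, and for each edge between $i$ and $j$ two arrows $i\to j$ and $j\to i$. Paths are composed from left to right, so $(i\to j)\cdot(j\to k)=(i\to j\to k)$; $e_i$ denotes the length-zero path at $i$. If $\Gamma$ has at least three vertices, $Z(\Gamma)$ is the quotient of the path algebra $\mathbb{K}Q$ by the relations $i\to j\to k=0$ for $i\neq k$, and $i\to j\to i=i\to k\to i$ for all neighbors $j,k$ of $i$. If $\Gamma$ has two vertices, $Z(\Gamma)$ is $\mathbb{K}Q$ modulo all paths of length three. In these cases put $x_i=i\to j\to i$ for any neighbor $j$ of $i$. If $\Gamma$ has one vertex $i$, $Z(\Gamma)=\mathbb{K}[x_i]/(x_i^2)$. In all cases $Z(\Gamma)$ has $\mathbb{K}$-basis consisting of all $e_i$, all $x_i$ and all arrows $i\to j$. Quasi-hereditary. A two-sided ideal $J$ in a finite-dimensional algebra $R$ which is projective as a left $R$-module is called hereditary if $JJ=J$ and $J\,\mathrm{Rad}(R)\,J=0$, where $\mathrm{Rad}(R)$ is the Jacobson radical. A finite-dimensional algebra $R$ is quasi-hereditary if there is a chain of two-sided ideals $0=J_0\subset J_1\subset\dots\subset J_{k-1}\subset J_k=R$ (strict inclusions), for some $k\geq 1$, such that each $J_l/J_{l-1}$ is a hereditary ideal of $R/J_{l-1}$.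 *)

theory Defs
  imports "Graph_Theory.Graph_Theory" "HOL-Algebra.Algebra"
begin

section \<open>Path algebras\<close>

text \<open>
  A quiver is a \<^typ>\<open>('a, 'b) pre_digraph\<close>. The path starting at \<open>u\<close> and running through the
  list of arcs \<open>p\<close> is the pair \<open>(u, p)\<close>; thus \<open>(u, [])\<close> is the path of length zero at \<open>u\<close>.
\<close>

definition quiver_paths :: "('a, 'b) pre_digraph \<Rightarrow> ('a \<times> 'b list) set" where
  "quiver_paths Q = {(u, p). \<exists>v. pre_digraph.awalk Q u p v}"

text \<open>
  Elements are finitely supported coefficient functions on paths. Concatenation is from left to
  right, and the coefficient of a product at a path is the sum over all ways of cutting that path
  into an initial and a final part.
\<close>

definition path_algebra ::
    "('k, 'm) ring_scheme \<Rightarrow> ('a, 'b) pre_digraph \<Rightarrow> ('a \<times> 'b list \<Rightarrow> 'k) ring" where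
  "path_algebra K Q = \<lparr>
     carrier = {f. range f \<subseteq> carrier K \<and> {w. f w \<noteq> \<zero>\<^bsub>K\<^esub>} \<subseteq> quiver_paths Q
                   \<and> finite {w. f w \<noteq> \<zero>\<^bsub>K\<^esub>}},
     monoid.mult = (\<lambda>f g (u, p). \<Oplus>\<^bsub>K\<^esub>n \<in> {..length p}.
               f (u, take n p) \<otimes>\<^bsub>K\<^esub> g (pre_digraph.awlast Q u (take n p), drop n p)),
     one = (\<lambda>(u, p). if u \<in> verts Q \<and> p = [] then \<one>\<^bsub>K\<^esub> else \<zero>\<^bsub>K\<^esub>),
     ring.zero = (\<lambda>_. \<zero>\<^bsub>K\<^esub>),
     add = (\<lambda>f g w. f w \<oplus>\<^bsub>K\<^esub> g w)\<rparr>"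

definition path_basis :: "('k, 'm) ring_scheme \<Rightarrow> 'a \<times> 'b list \<Rightarrow> ('a \<times> 'b list \<Rightarrow> 'k)" where
  "path_basis K w = (\<lambda>w'. if w' = w then \<one>\<^bsub>K\<^esub> else \<zero>\<^bsub>K\<^esub>)"


section \<open>Zigzag algebras\<close>

text \<open>
  In the library a simple graph is a symmetric digraph without loops and multiple arcs: an edge
  between \<open>i\<close> and \<open>j\<close> is represented by one arc from \<open>i\<close> to \<open>j\<close> and one from \<open>j\<close> to \<open>i\<close>. Hence
  such a graph, read as a quiver, is its own double quiver.

  The first set below consists of the paths \<open>i \<rightarrow> j \<rightarrow> k\<close> with \<open>i \<noteq> k\<close>, the second one of the
  differences of \<open>i \<rightarrow> j \<rightarrow> i\<close> and \<open>i \<rightarrow> k \<rightarrow> i\<close>.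
\<close>

definition zigzag_relations ::
    "('k, 'm) ring_scheme \<Rightarrow> ('a, 'b) pre_digraph \<Rightarrow> ('a \<times> 'b list \<Rightarrow> 'k) set" where
  "zigzag_relations K G =
     {path_basis K (i, [a, b]) | i a b k.
        pre_digraph.awalk G i [a, b] k \<and> i \<noteq> k} \<union>
     {path_basis K (i, [a, b]) \<ominus>\<^bsub>path_algebra K G\<^esub> path_basis K (i, [c, d]) | i a b c d.
        pre_digraph.awalk G i [a, b] i \<and> pre_digraph.awalk G i [c, d] i}"

definition length_three_paths ::
    "('k, 'm) ring_scheme \<Rightarrow> ('a, 'b) pre_digraph \<Rightarrow> ('a \<times> 'b list \<Rightarrow> 'k) set" where
  "length_three_paths K G = {path_basis K (i, p) | i p. (i, p) \<in> quiver_paths G \<and> length p = 3}"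

text \<open>
  The algebra of the one-vertex graph is a quotient of a polynomial ring and the others are
  quotients of path algebras. The injections \<^const>\<open>Inl\<close> and \<^const>\<open>Inr\<close> only relabel elements, so
  that all of them are rings over one type.
\<close>

definition zigzag_algebra ::
    "('k, 'm) ring_scheme \<Rightarrow> ('a, 'b) pre_digraph
     \<Rightarrow> ((nat \<Rightarrow> 'k) set + ('a \<times> 'b list \<Rightarrow> 'k) set) ring" where
  "zigzag_algebra K G =
     (if card (verts G) = 1 then
        image_ring Inl (UP K Quot (Idl\<^bsub>UP K\<^esub> {monom (UP K) \<one>\<^bsub>K\<^esub> 2}))
      else if card (verts G) = 2 then
        image_ring Inr (path_algebra K G Quot (Idl\<^bsub>path_algebra K G\<^esub> (length_three_paths K G)))
      else
        image_ring Inr (path_algebra K G Quot (Idl\<^bsub>path_algebra K G\<^esub> (zigzag_relations K G))))"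


section \<open>Left modules over noncommutative rings\<close>

text \<open>
  The library's locale \<^locale>\<open>module\<close> requires a commutative ring of scalars. As there, the fields
  \<^const>\<open>monoid.mult\<close> and \<^const>\<open>one\<close> of a module record play no role.
\<close>

locale left_module = R?: ring R + M?: abelian_group M
  for R :: "('a, 'r) ring_scheme" (structure) and M :: "('a, 'b, 'm) module_scheme" (structure) +
  assumes smult_closed: "\<lbrakk>a \<in> carrier R; x \<in> carrier M\<rbrakk> \<Longrightarrow> a \<odot>\<^bsub>M\<^esub> x \<in> carrier M"
    and smult_l_distr: "\<lbrakk>a \<in> carrier R; b \<in> carrier R; x \<in> carrier M\<rbrakk> \<Longrightarrow>
      (a \<oplus>\<^bsub>R\<^esub> b) \<odot>\<^bsub>M\<^esub> x = a \<odot>\<^bsub>M\<^esub> x \<oplus>\<^bsub>M\<^esub> b \<odot>\<^bsub>M\<^esub> x"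
    and smult_r_distr: "\<lbrakk>a \<in> carrier R; x \<in> carrier M; y \<in> carrier M\<rbrakk> \<Longrightarrow>
      a \<odot>\<^bsub>M\<^esub> (x \<oplus>\<^bsub>M\<^esub> y) = a \<odot>\<^bsub>M\<^esub> x \<oplus>\<^bsub>M\<^esub> a \<odot>\<^bsub>M\<^esub> y"
    and smult_assoc: "\<lbrakk>a \<in> carrier R; b \<in> carrier R; x \<in> carrier M\<rbrakk> \<Longrightarrow>
      (a \<otimes>\<^bsub>R\<^esub> b) \<odot>\<^bsub>M\<^esub> x = a \<odot>\<^bsub>M\<^esub> (b \<odot>\<^bsub>M\<^esub> x)"
    and smult_one: "x \<in> carrier M \<Longrightarrow> \<one>\<^bsub>R\<^esub> \<odot>\<^bsub>M\<^esub> x = x"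

definition left_module_hom ::
    "('a, 'r) ring_scheme \<Rightarrow> ('a, 'b, 'm) module_scheme \<Rightarrow> ('a, 'c, 'n) module_scheme
     \<Rightarrow> ('b \<Rightarrow> 'c) set" where
  "left_module_hom R M N = {h. h \<in> carrier M \<rightarrow> carrier N \<and>
     (\<forall>x\<in>carrier M. \<forall>y\<in>carrier M. h (x \<oplus>\<^bsub>M\<^esub> y) = h x \<oplus>\<^bsub>N\<^esub> h y) \<and>
     (\<forall>a\<in>carrier R. \<forall>x\<in>carrier M. h (a \<odot>\<^bsub>M\<^esub> x) = a \<odot>\<^bsub>N\<^esub> h x)}"

definition free_left_module ::
    "('a, 'r) ring_scheme \<Rightarrow> 'c set \<Rightarrow> ('a, 'c \<Rightarrow> 'a) module" where
  "free_left_module R B = \<lparr>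
     carrier = {f. range f \<subseteq> carrier R \<and> {x. f x \<noteq> \<zero>\<^bsub>R\<^esub>} \<subseteq> B \<and> finite {x. f x \<noteq> \<zero>\<^bsub>R\<^esub>}},
     monoid.mult = undefined,
     one = undefined,
     ring.zero = (\<lambda>_. \<zero>\<^bsub>R\<^esub>),
     add = (\<lambda>f g x. f x \<oplus>\<^bsub>R\<^esub> g x),
     smult = (\<lambda>a f x. a \<otimes>\<^bsub>R\<^esub> f x)\<rparr>"

text \<open>
  A module is projective if it is a direct summand of a free module. Bases may be taken among
  subsets of the element type of \<open>P\<close>, because \<open>P\<close> is a quotient of the free module on its carrier
  and this quotient splits when \<open>P\<close> is projective.
\<close>

definition projective_left_module ::
    "('a, 'r) ring_scheme \<Rightarrow> ('a, 'b, 'm) module_scheme \<Rightarrow> bool" where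
  "projective_left_module R P \<longleftrightarrow> left_module R P \<and>
     (\<exists>(B :: 'b set) i p. i \<in> left_module_hom R P (free_left_module R B) \<and>
        p \<in> left_module_hom R (free_left_module R B) P \<and> (\<forall>x\<in>carrier P. p (i x) = x))"

definition left_ideal :: "'a set \<Rightarrow> ('a, 'r) ring_scheme \<Rightarrow> bool" where
  "left_ideal I R \<longleftrightarrow> additive_subgroup I R \<and> (\<forall>a\<in>carrier R. \<forall>x\<in>I. a \<otimes>\<^bsub>R\<^esub> x \<in> I)"

definition left_ideal_module :: "('a, 'r) ring_scheme \<Rightarrow> 'a set \<Rightarrow> ('a, 'a) module" where
  "left_ideal_module R I = \<lparr>
     carrier = I,
     monoid.mult = monoid.mult R,
     one = one R,
     ring.zero = ring.zero R,
     add = add R,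
     smult = monoid.mult R\<rparr>"

definition maximal_left_ideal :: "'a set \<Rightarrow> ('a, 'r) ring_scheme \<Rightarrow> bool" where
  "maximal_left_ideal I R \<longleftrightarrow> left_ideal I R \<and> I \<noteq> carrier R \<and>
     (\<forall>I'. left_ideal I' R \<and> I \<subseteq> I' \<longrightarrow> I' = I \<or> I' = carrier R)"

text \<open>The intersection with the carrier matters only for the zero ring.\<close>

definition jacobson_radical :: "('a, 'r) ring_scheme \<Rightarrow> 'a set" where
  "jacobson_radical R = carrier R \<inter> \<Inter>{I. maximal_left_ideal I R}"


section \<open>Quasi-hereditary algebras\<close>

text \<open>
  In a unital algebra over a field the two-sided ideals, the maximal left ideals and the
  projective modules are those of the underlying ring, so the scalars do not occur below. The
  notions are intended for finite-dimensional algebras.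
\<close>

definition hereditary_ideal :: "'a set \<Rightarrow> ('a, 'r) ring_scheme \<Rightarrow> bool" where
  "hereditary_ideal J R \<longleftrightarrow> ideal J R \<and> projective_left_module R (left_ideal_module R J) \<and>
     J \<cdot>\<^bsub>R\<^esub> J = J \<and> J \<cdot>\<^bsub>R\<^esub> jacobson_radical R \<cdot>\<^bsub>R\<^esub> J = {\<zero>\<^bsub>R\<^esub>}"

text \<open>The image of \<open>J (Suc l)\<close> under \<^term>\<open>\<lambda>x. J l +>\<^bsub>R\<^esub> x\<close> is the ideal \<open>J (Suc l) / J l\<close>.\<close>

definition quasi_hereditary :: "('a, 'r) ring_scheme \<Rightarrow> bool" where
  "quasi_hereditary R \<longleftrightarrow> (\<exists>k (J :: nat \<Rightarrow> 'a set). 1 \<le> k \<and>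
     (\<forall>l\<le>k. ideal (J l) R) \<and> J 0 = {\<zero>\<^bsub>R\<^esub>} \<and> J k = carrier R \<and>
     (\<forall>l<k. J l \<subset> J (Suc l) \<and>
        hereditary_ideal ((\<lambda>x. J l +>\<^bsub>R\<^esub> x) ` J (Suc l)) (R Quot J l)))"

end

theory Submission
  imports Defs
begin

text \<open>
  The ideal \<open>J = J 1\<close> of a heredity chain is nonzero with \<open>JJ = J\<close>, so it is not contained in the
  nilpotent ideal spanned by the paths of positive length. Hence some \<open>y \<in> J\<close> has a nonzero
  coefficient \<open>c\<close> at an idempotent \<open>e\<^sub>i\<close>. As \<open>x\<^sub>i Z x\<^sub>i = 0\<close>, the element \<open>x\<^sub>i\<close> lies in the Jacobson
  radical, so \<open>y x\<^sub>i y \<in> J Rad(Z) J = 0\<close>; but the coefficient of \<open>y x\<^sub>i y\<close> at \<open>x\<^sub>i\<close> is \<open>c\<^sup>2 \<noteq> 0\<close>.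
  Working in the path algebra, the coefficient at \<open>x\<^sub>i\<close> becomes the sum of the coefficients at all
  closed paths of length two at \<open>i\<close>.
\<close>

text \<open>The ideal \<open>I\<close> of relations is given only by generators, so it is squeezed
  instead of being computed: \<open>length_ge 3\<close> lies in \<open>I\<close>, and
  \<open>I\<close> lies in \<open>loop_kernel\<close>. The lower bound supplies everything that must
  vanish in Z, namely products of four elements without idempotent part and all products z r z. The
  upper bound supplies the one thing that must not vanish, y z y. The obstacle is the lower bound
  for graphs other than the one on two vertices, where it needs a third vertex next to any given
  edge. The upper bound rests on the loop sum at i being a linear functional with value 1 on every
  closed path of length two at i: it cannot tell apart the loops that represent x_i, so no
  representative has to be chosen.\<close>

section \<open>Hereditary ideals\<close>

text \<open>If z avoids a maximal left ideal L, then L + Rz is the whole ring and 1 = l + r z.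
  Multiplying by z from the left kills the second term and leaves z = z l in L.\<close>

lemma (in ring) square_zero_imp_jacobson:
  assumes z: "z \<in> carrier R" and zrz: "\<And>r. r \<in> carrier R \<Longrightarrow> z \<otimes> r \<otimes> z = \<zero>"
  shows "z \<in> jacobson_radical R"
proof -
  have "z \<in> L" if max: "maximal_left_ideal L R" for L
  proof (rule ccontr)
    assume nz: "z \<notin> L"
    have L: "additive_subgroup L R" and Ll: "\<And>a x. a \<in> carrier R \<Longrightarrow> x \<in> L \<Longrightarrow> a \<otimes> x \<in> L"
      and Lm: "\<And>L'. left_ideal L' R \<Longrightarrow> L \<subseteq> L' \<Longrightarrow> L' = L \<or> L' = carrier R"
      using max unfolding maximal_left_ideal_def left_ideal_def by auto
    interpret L: additive_subgroup L R by (rule L)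
    define L' where "L' = {l \<oplus> r \<otimes> z | l r. l \<in> L \<and> r \<in> carrier R}"
    have Lc: "l \<in> L \<Longrightarrow> l \<in> carrier R" for l using L.a_Hcarr by auto
    have "additive_subgroup L' R"
    proof (rule additive_subgroupI, rule add.subgroupI)
      show "L' \<subseteq> carrier R" by (auto simp: L'_def z Lc)
      show "L' \<noteq> {}" using L.zero_closed unfolding L'_def by blast
    next
      fix a assume "a \<in> L'"
      then obtain l r where a: "a = l \<oplus> r \<otimes> z" "l \<in> L" "r \<in> carrier R" by (auto simp: L'_def)
      have "\<ominus> a = (\<ominus> l) \<oplus> (\<ominus> r) \<otimes> z"
        using a z Lc by (simp add: minus_add l_minus)
      then show "\<ominus> a \<in> L'"
        using a L.a_inv_closed by (auto simp: L'_def)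
    next
      fix a b assume "a \<in> L'" "b \<in> L'"
      then obtain l r l' r' where a: "a = l \<oplus> r \<otimes> z" "l \<in> L" "r \<in> carrier R"
        and b: "b = l' \<oplus> r' \<otimes> z" "l' \<in> L" "r' \<in> carrier R" by (auto simp: L'_def)
      have "a \<oplus> b = (l \<oplus> l') \<oplus> (r \<oplus> r') \<otimes> z"
        using a b z Lc by (simp add: l_distr a_ac)
      then show "a \<oplus> b \<in> L'"
        using a b unfolding L'_def by blast
    qed
    moreover have "a \<otimes> x \<in> L'" if ax: "a \<in> carrier R" "x \<in> L'" for a x
    proof -
      obtain l r where x: "x = l \<oplus> r \<otimes> z" "l \<in> L" "r \<in> carrier R" using ax by (auto simp: L'_def)
      have "a \<otimes> x = a \<otimes> l \<oplus> (a \<otimes> r) \<otimes> z" using x ax z Lc by (simp add: r_distr m_assoc)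
      then show ?thesis using x ax Ll unfolding L'_def by blast
    qed
    ultimately have "left_ideal L' R" by (auto simp: left_ideal_def)
    moreover have "L \<subseteq> L'"
    proof
      fix l assume "l \<in> L"
      moreover from this have "l = l \<oplus> \<zero> \<otimes> z" using z Lc by simp
      ultimately show "l \<in> L'" unfolding L'_def by blast
    qed
    moreover have "z \<in> L'"
    proof -
      have "z = \<zero> \<oplus> \<one> \<otimes> z" using z by simp
      then show ?thesis unfolding L'_def using L.zero_closed by blast
    qed
    ultimately have "L' = carrier R" using Lm nz by blast
    then have "\<one> \<in> L'" by simp
    then obtain l r where lr: "\<one> = l \<oplus> r \<otimes> z" "l \<in> L" "r \<in> carrier R" by (auto simp: L'_def)
    have "z = z \<otimes> (l \<oplus> r \<otimes> z)" using z by (simp flip: lr(1))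
    also have "\<dots> = z \<otimes> l" using zrz[OF lr(3)] lr z Lc by (simp add: r_distr m_assoc)
    finally show False using Ll[OF z lr(2)] nz by simp
  qed
  then show ?thesis by (auto simp: jacobson_radical_def z)
qed

text \<open>An element y of \<open>J\<close> outside \<open>N\<close> would give a nonzero y z y in
  J Rad(R) J, with z in the radical because z R z = 0. Once \<open>J\<close> lies in
  \<open>N\<close>, writing J = (JJ)(JJ) turns the vanishing of fourfold products into J = 0.
  \<open>N\<close> is a mere set here; sums are taken inside \<open>J\<close>.\<close>

lemma (in ring) hereditary_ideal_eq_zero:
  assumes N: "N \<subseteq> carrier R"
    and nil: "\<And>a b c d. \<lbrakk>a \<in> N; b \<in> N; c \<in> N; d \<in> N\<rbrakk> \<Longrightarrow> (a \<otimes> b) \<otimes> (c \<otimes> d) = \<zero>"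
    and sep: "\<And>y. \<lbrakk>y \<in> carrier R; y \<notin> N\<rbrakk> \<Longrightarrow>
      \<exists>z\<in>carrier R. (\<forall>r\<in>carrier R. z \<otimes> r \<otimes> z = \<zero>) \<and> y \<otimes> z \<otimes> y \<noteq> \<zero>"
    and her: "hereditary_ideal J R"
  shows "J = {\<zero>}"
proof -
  have J: "ideal J R" and JJ: "J \<cdot> J = J" and JradJ: "J \<cdot> jacobson_radical R \<cdot> J = {\<zero>}"
    using her by (auto simp: hereditary_ideal_def)
  interpret J: ideal J R by (rule J)
  have JN: "J \<subseteq> N"
  proof
    fix y assume y: "y \<in> J"
    show "y \<in> N"
    proof (rule ccontr)
      assume "y \<notin> N"
      then obtain z where z: "z \<in> carrier R" "\<And>r. r \<in> carrier R \<Longrightarrow> z \<otimes> r \<otimes> z = \<zero>"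
        and ne: "y \<otimes> z \<otimes> y \<noteq> \<zero>"
        using sep[of y] y J.Icarr by blast
      have "y \<otimes> z \<otimes> y \<in> J \<cdot> jacobson_radical R \<cdot> J"
        by (intro ideal_prod.prod y square_zero_imp_jacobson z)
      then show False using JradJ ne by simp
    qed
  qed
  \<comment> \<open>Induction on \<open>ideal_prod\<close> spends one use of JJ = J at a time: on
    the left factor here, on the right factor in \<open>xy\<close>, and at last on the element
    itself.\<close>
  have xcd: "x \<otimes> (c \<otimes> d) = \<zero>" if x: "x \<in> J" and cd: "c \<in> J" "d \<in> J" for x c d
  proof -
    have "x \<in> J \<cdot> J" using x JJ by simp
    then show ?thesis
    proof induction
      case (prod i j)
      then show ?case using cd JN by (intro nil) auto
    next
      case (sum s t)
      then have "s \<in> carrier R" "t \<in> carrier R" using JJ J.Icarr by auto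
      then show ?case using sum.IH cd J.Icarr by (simp add: l_distr)
    qed
  qed
  have xy: "x \<otimes> y = \<zero>" if x: "x \<in> J" and y: "y \<in> J" for x y
  proof -
    have "y \<in> J \<cdot> J" using y JJ by simp
    then show ?thesis
    proof induction
      case (prod i j)
      then show ?case using x by (rule_tac xcd)
    next
      case (sum s t)
      then have "s \<in> carrier R" "t \<in> carrier R" using JJ J.Icarr by auto
      then show ?case using sum.IH x J.Icarr by (simp add: r_distr)
    qed
  qed
  have "x = \<zero>" if "x \<in> J" for x
  proof -
    have "x \<in> J \<cdot> J" using that JJ by simp
    then show ?thesis
    proof induction
      case (prod i j)
      then show ?case by (rule xy)
    next
      case (sum s t)
      then show ?case by simp
    qed
  qed
  moreover have "\<zero> \<in> J" by simp
  ultimately show ?thesis by blast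
qed

text \<open>Already the first step of a chain is impossible. Since \<open>J 0\<close> is zero,
  \<open>R Quot J 0\<close> is a copy of \<open>R\<close> made of singleton cosets, and the
  hypotheses travel there along the injective homomorphism \<open>\<pi>\<close>. The ring structure
  of \<open>R\<close> comes from the ideals of the assumed chain.\<close>

lemma not_quasi_hereditary_if:
  assumes N: "N \<subseteq> carrier R"
    and nil: "\<And>a b c d. \<lbrakk>a \<in> N; b \<in> N; c \<in> N; d \<in> N\<rbrakk> \<Longrightarrow> (a \<otimes>\<^bsub>R\<^esub> b) \<otimes>\<^bsub>R\<^esub> (c \<otimes>\<^bsub>R\<^esub> d) = \<zero>\<^bsub>R\<^esub>"
    and sep: "\<And>y. \<lbrakk>y \<in> carrier R; y \<notin> N\<rbrakk> \<Longrightarrow>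
      \<exists>z\<in>carrier R. (\<forall>r\<in>carrier R. z \<otimes>\<^bsub>R\<^esub> r \<otimes>\<^bsub>R\<^esub> z = \<zero>\<^bsub>R\<^esub>) \<and> y \<otimes>\<^bsub>R\<^esub> z \<otimes>\<^bsub>R\<^esub> y \<noteq> \<zero>\<^bsub>R\<^esub>"
  shows "\<not> quasi_hereditary R"
proof
  assume "quasi_hereditary R"
  then obtain k J where k: "1 \<le> k" and J: "\<And>l. l \<le> k \<Longrightarrow> ideal (J l) R" and J0: "J 0 = {\<zero>\<^bsub>R\<^esub>}"
    and her: "\<And>l. l < k \<Longrightarrow> J l \<subset> J (Suc l) \<and>
        hereditary_ideal ((\<lambda>x. J l +>\<^bsub>R\<^esub> x) ` J (Suc l)) (R Quot J l)"
    unfolding quasi_hereditary_def by blast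
  interpret J0: ideal "J 0" R by (rule J) simp
  interpret J1: ideal "J 1" R by (rule J) (rule k)
  define \<pi> where "\<pi> = (\<lambda>x. J 0 +>\<^bsub>R\<^esub> x)"
  interpret Q: ring "R Quot J 0" by (rule J0.quotient_is_ring)
  have hom: "\<pi> \<in> ring_hom R (R Quot J 0)" using J0.rcos_ring_hom by (simp add: \<pi>_def)
  have surj: "\<pi> ` carrier R = carrier (R Quot J 0)"
    by (auto simp: \<pi>_def FactRing_def A_RCOSETS_def')
  have \<pi>0: "\<pi> x = \<zero>\<^bsub>R Quot J 0\<^esub> \<longleftrightarrow> x = \<zero>\<^bsub>R\<^esub>" if "x \<in> carrier R" for x
    using that by (auto simp: \<pi>_def J0 FactRing_def a_r_coset_def')
  have her1: "hereditary_ideal (\<pi> ` J 1) (R Quot J 0)"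
    using her[of 0] k by (simp add: \<pi>_def)
  have "\<pi> ` J 1 = {\<zero>\<^bsub>R Quot J 0\<^esub>}"
  proof (rule Q.hereditary_ideal_eq_zero[where N = "\<pi> ` N", OF _ _ _ her1])
    show "\<pi> ` N \<subseteq> carrier (R Quot J 0)" using N surj by blast
    fix a b c d assume "a \<in> \<pi> ` N" "b \<in> \<pi> ` N" "c \<in> \<pi> ` N" "d \<in> \<pi> ` N"
    then obtain a' b' c' d' where *: "a = \<pi> a'" "b = \<pi> b'" "c = \<pi> c'" "d = \<pi> d'"
      and n: "a' \<in> N" "b' \<in> N" "c' \<in> N" "d' \<in> N" by blast
    then have c: "a' \<in> carrier R" "b' \<in> carrier R" "c' \<in> carrier R" "d' \<in> carrier R" using N by auto
    show "(a \<otimes>\<^bsub>R Quot J 0\<^esub> b) \<otimes>\<^bsub>R Quot J 0\<^esub> (c \<otimes>\<^bsub>R Quot J 0\<^esub> d) = \<zero>\<^bsub>R Quot J 0\<^esub>"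
      using nil[OF n] \<pi>0[of "(a' \<otimes>\<^bsub>R\<^esub> b') \<otimes>\<^bsub>R\<^esub> (c' \<otimes>\<^bsub>R\<^esub> d')"] c
      by (simp add: * ring_hom_mult[OF hom, symmetric])
  next
    fix y assume y: "y \<in> carrier (R Quot J 0)" "y \<notin> \<pi> ` N"
    then obtain y' where y': "y = \<pi> y'" "y' \<in> carrier R" "y' \<notin> N" by (auto simp flip: surj)
    from sep[OF y'(2,3)] obtain z where z: "z \<in> carrier R"
      "\<And>r. r \<in> carrier R \<Longrightarrow> z \<otimes>\<^bsub>R\<^esub> r \<otimes>\<^bsub>R\<^esub> z = \<zero>\<^bsub>R\<^esub>" "y' \<otimes>\<^bsub>R\<^esub> z \<otimes>\<^bsub>R\<^esub> y' \<noteq> \<zero>\<^bsub>R\<^esub>" by blast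
    have "\<pi> z \<otimes>\<^bsub>R Quot J 0\<^esub> r \<otimes>\<^bsub>R Quot J 0\<^esub> \<pi> z = \<zero>\<^bsub>R Quot J 0\<^esub>" if "r \<in> carrier (R Quot J 0)" for r
    proof -
      obtain r' where r: "r = \<pi> r'" "r' \<in> carrier R" using \<open>r \<in> _\<close> by (auto simp flip: surj)
      then show ?thesis
        using z(1) z(2)[OF r(2)] \<pi>0[of "z \<otimes>\<^bsub>R\<^esub> r' \<otimes>\<^bsub>R\<^esub> z"] by (simp add: ring_hom_mult[OF hom, symmetric])
    qed
    moreover have "y \<otimes>\<^bsub>R Quot J 0\<^esub> \<pi> z \<otimes>\<^bsub>R Quot J 0\<^esub> y \<noteq> \<zero>\<^bsub>R Quot J 0\<^esub>"
      using z(1,3) y' \<pi>0[of "y' \<otimes>\<^bsub>R\<^esub> z \<otimes>\<^bsub>R\<^esub> y'"] by (simp add: ring_hom_mult[OF hom, symmetric])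
    moreover have "\<pi> z \<in> carrier (R Quot J 0)" using z(1) by (auto simp flip: surj)
    ultimately show "\<exists>z\<in>carrier (R Quot J 0). (\<forall>r\<in>carrier (R Quot J 0).
        z \<otimes>\<^bsub>R Quot J 0\<^esub> r \<otimes>\<^bsub>R Quot J 0\<^esub> z = \<zero>\<^bsub>R Quot J 0\<^esub>) \<and> y \<otimes>\<^bsub>R Quot J 0\<^esub> z \<otimes>\<^bsub>R Quot J 0\<^esub> y \<noteq> \<zero>\<^bsub>R Quot J 0\<^esub>"
      by blast
  qed
  then have "J 1 \<subseteq> {\<zero>\<^bsub>R\<^esub>}" using \<pi>0[OF J1.Icarr] imageI[of _ "J 1" \<pi>] by auto
  then show False using her[of 0] k J0 by auto
qed

text \<open>As \<open>f\<close> is injective, sending x to the relabelled coset of x is a surjective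
  homomorphism with kernel \<open>I\<close>. Vanishing in the zigzag algebra thus becomes membership
  in \<open>I\<close>, and all later computations can stay in \<open>A\<close>.\<close>

lemma not_quasi_hereditary_image_quot:
  assumes I: "ideal I A" and f: "inj f" and N: "N \<subseteq> carrier A"
    and nil: "\<And>a b c d. \<lbrakk>a \<in> N; b \<in> N; c \<in> N; d \<in> N\<rbrakk> \<Longrightarrow> (a \<otimes>\<^bsub>A\<^esub> b) \<otimes>\<^bsub>A\<^esub> (c \<otimes>\<^bsub>A\<^esub> d) \<in> I"
    and sep: "\<And>y. \<lbrakk>y \<in> carrier A; y \<notin> N\<rbrakk> \<Longrightarrow>
      \<exists>z\<in>carrier A. (\<forall>r\<in>carrier A. z \<otimes>\<^bsub>A\<^esub> r \<otimes>\<^bsub>A\<^esub> z \<in> I) \<and> y \<otimes>\<^bsub>A\<^esub> z \<otimes>\<^bsub>A\<^esub> y \<notin> I"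
  shows "\<not> quasi_hereditary (image_ring f (A Quot I))"
proof -
  interpret I: ideal I A by (rule I)
  interpret Q: ring "A Quot I" by (rule I.quotient_is_ring)
  define h where "h = (\<lambda>x. f (I +>\<^bsub>A\<^esub> x))"
  define R where "R = image_ring f (A Quot I)"
  have iso: "f \<in> ring_iso (A Quot I) R"
    unfolding R_def by (rule inj_imp_image_ring_iso) (rule inj_on_subset[OF f subset_UNIV])
  have hom: "h \<in> ring_hom A R"
    using ring_hom_trans[OF I.rcos_ring_hom, of f R] iso by (simp add: h_def ring_iso_def comp_def)
  have surj: "h ` carrier A = carrier R"
    by (auto simp: h_def R_def image_ring_carrier FactRing_def A_RCOSETS_def')
  have h0: "h x = \<zero>\<^bsub>R\<^esub> \<longleftrightarrow> x \<in> I" if "x \<in> carrier A" for x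
  proof -
    have "\<zero>\<^bsub>R\<^esub> = f I" by (simp add: R_def image_ring_zero FactRing_def)
    then have "h x = \<zero>\<^bsub>R\<^esub> \<longleftrightarrow> I +>\<^bsub>A\<^esub> x = I" using inj_eq[OF f] by (simp add: h_def)
    then show ?thesis
      using that I.a_rcos_const I.rcos_const_imp_mem by metis
  qed
  show ?thesis unfolding R_def[symmetric]
  proof (rule not_quasi_hereditary_if[where N = "h ` N"])
    show "h ` N \<subseteq> carrier R" using N surj by blast
    fix a b c d assume "a \<in> h ` N" "b \<in> h ` N" "c \<in> h ` N" "d \<in> h ` N"
    then obtain a' b' c' d' where *: "a = h a'" "b = h b'" "c = h c'" "d = h d'"
      and n: "a' \<in> N" "b' \<in> N" "c' \<in> N" "d' \<in> N" by blast
    then have c: "a' \<in> carrier A" "b' \<in> carrier A" "c' \<in> carrier A" "d' \<in> carrier A" using N by auto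
    show "(a \<otimes>\<^bsub>R\<^esub> b) \<otimes>\<^bsub>R\<^esub> (c \<otimes>\<^bsub>R\<^esub> d) = \<zero>\<^bsub>R\<^esub>"
      using nil[OF n] h0[of "(a' \<otimes>\<^bsub>A\<^esub> b') \<otimes>\<^bsub>A\<^esub> (c' \<otimes>\<^bsub>A\<^esub> d')"] c
      by (simp add: * ring_hom_mult[OF hom, symmetric])
  next
    fix y assume y: "y \<in> carrier R" "y \<notin> h ` N"
    then obtain y' where y': "y = h y'" "y' \<in> carrier A" "y' \<notin> N" by (auto simp flip: surj)
    from sep[OF y'(2,3)] obtain z where z: "z \<in> carrier A"
      "\<And>r. r \<in> carrier A \<Longrightarrow> z \<otimes>\<^bsub>A\<^esub> r \<otimes>\<^bsub>A\<^esub> z \<in> I" "y' \<otimes>\<^bsub>A\<^esub> z \<otimes>\<^bsub>A\<^esub> y' \<notin> I" by blast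
    have "h z \<otimes>\<^bsub>R\<^esub> r \<otimes>\<^bsub>R\<^esub> h z = \<zero>\<^bsub>R\<^esub>" if "r \<in> carrier R" for r
    proof -
      obtain r' where r: "r = h r'" "r' \<in> carrier A" using \<open>r \<in> _\<close> by (auto simp flip: surj)
      then show ?thesis
        using z(1) z(2)[OF r(2)] h0[of "z \<otimes>\<^bsub>A\<^esub> r' \<otimes>\<^bsub>A\<^esub> z"] by (simp add: ring_hom_mult[OF hom, symmetric])
    qed
    moreover have "y \<otimes>\<^bsub>R\<^esub> h z \<otimes>\<^bsub>R\<^esub> y \<noteq> \<zero>\<^bsub>R\<^esub>"
      using z(1,3) y' h0[of "y' \<otimes>\<^bsub>A\<^esub> z \<otimes>\<^bsub>A\<^esub> y'"] by (simp add: ring_hom_mult[OF hom, symmetric])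
    moreover have "h z \<in> carrier R" using z(1) by (auto simp flip: surj)
    ultimately show "\<exists>z\<in>carrier R. (\<forall>r\<in>carrier R. z \<otimes>\<^bsub>R\<^esub> r \<otimes>\<^bsub>R\<^esub> z = \<zero>\<^bsub>R\<^esub>) \<and> y \<otimes>\<^bsub>R\<^esub> z \<otimes>\<^bsub>R\<^esub> y \<noteq> \<zero>\<^bsub>R\<^esub>"
      by blast
  qed
qed

section \<open>The one-vertex graph: dual numbers\<close>

lemma not_quasi_hereditary_dual_numbers:
  assumes "field K" and f: "inj f"
  shows "\<not> quasi_hereditary (image_ring f (UP K Quot (Idl\<^bsub>UP K\<^esub> {monom (UP K) \<one>\<^bsub>K\<^esub> 2})))"
proof -
  have carr: "carrier (UP K) = up K" and coeff_eq: "\<And>p. p \<in> up K \<Longrightarrow> up_ring.coeff (UP K) p = p"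
    by (simp_all add: UP_def)
  interpret K: field K by fact
  interpret UP_cring K "UP K" by unfold_locales auto
  define C where "C = up_ring.coeff (UP K)"
  \<comment> \<open>The ideal of X^2 in terms of coefficients; \<open>N\<close> is the ideal of X.
    Both inclusions between \<open>I\<close> and the generated ideal matter: one makes products
    vanish, the other keeps y X y from vanishing.\<close>
  define I where "I = {p \<in> carrier (UP K). C p 0 = \<zero>\<^bsub>K\<^esub> \<and> C p 1 = \<zero>\<^bsub>K\<^esub>}"
  define N where "N = {p \<in> carrier (UP K). C p 0 = \<zero>\<^bsub>K\<^esub>}"
  let ?m = "up_ring.monom (UP K) \<one>\<^bsub>K\<^esub> 2"
  have C0: "C (p \<otimes>\<^bsub>UP K\<^esub> q) 0 = C p 0 \<otimes>\<^bsub>K\<^esub> C q 0" if "p \<in> carrier (UP K)" "q \<in> carrier (UP K)" for p q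
    using that by (simp add: C_def)
  have C1: "C (p \<otimes>\<^bsub>UP K\<^esub> q) 1 = C p 1 \<otimes>\<^bsub>K\<^esub> C q 0 \<oplus>\<^bsub>K\<^esub> C p 0 \<otimes>\<^bsub>K\<^esub> C q 1" if "p \<in> carrier (UP K)" "q \<in> carrier (UP K)" for p q
    using that by (simp add: C_def)
  have Cc: "C p n \<in> carrier K" if "p \<in> carrier (UP K)" for p n using that by (simp add: C_def)
  have "ideal I (UP K)"
  proof (rule idealI)
    show "ring (UP K)" by (rule UP_ring)
    show "subgroup I (add_monoid (UP K))"
    proof (rule P.add.subgroupI)
      have "\<zero>\<^bsub>UP K\<^esub> \<in> I" by (simp add: I_def C_def)
      then show "I \<noteq> {}" by blast
      fix p assume "p \<in> I"
      then show "\<ominus>\<^bsub>UP K\<^esub> p \<in> I" by (simp add: I_def C_def)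
    qed (auto simp: I_def C_def)
  qed (auto simp: I_def C0 C1[unfolded One_nat_def] Cc)
  moreover have "?m \<in> I" by (simp add: I_def C_def)
  ultimately have "Idl\<^bsub>UP K\<^esub> {?m} \<subseteq> I" by (intro P.genideal_minimal) auto
  moreover have "I \<subseteq> Idl\<^bsub>UP K\<^esub> {?m}"
  proof
    fix p assume p: "p \<in> I"
    then have pc: "p \<in> carrier (UP K)" by (simp add: I_def)
    \<comment> \<open>The quotient of \<open>p\<close> by X^2. Shifting the function itself is
      legitimate because members of \<open>up K\<close> are their own coefficient sequences, by
      \<open>coeff_eq\<close>.\<close>
    define q where "q = (\<lambda>n. p (Suc (Suc n)))"
    have "p \<in> up K" using pc by (simp only: carr)
    then obtain n where "bound \<zero>\<^bsub>K\<^esub> n p" "\<And>n. p n \<in> carrier K" by (auto simp: up_def)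
    then have "q \<in> up K" by (auto simp: up_def q_def bound_def intro!: exI[of _ n])
    then have qc: "q \<in> carrier (UP K)" by (simp only: carr)
    have Cq: "up_ring.coeff (UP K) q n = up_ring.coeff (UP K) p (Suc (Suc n))" for n
      using coeff_eq[of p] coeff_eq[of q] pc qc by (simp only: carr q_def)
    have "p = ?m \<otimes>\<^bsub>UP K\<^esub> q"
    proof (rule up_eqI[OF _ pc])
      fix n
      show "up_ring.coeff (UP K) p n = up_ring.coeff (UP K) (?m \<otimes>\<^bsub>UP K\<^esub> q) n"
      proof (cases "n < 2")
        case True
        then have "n = 0 \<or> n = 1" by auto
        then show ?thesis using p qc by (auto simp: I_def C_def)
      next
        case False
        then obtain k where "n = k + 2" by (metis add.commute le_Suc_ex not_less)
        then show ?thesis using coeff_monom_mult[of "\<one>\<^bsub>K\<^esub>" q 2 k] qc pc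
          by (simp add: Cq add.commute del: coeff_mult)
      qed
    qed (use qc in simp)
    moreover have "?m \<in> Idl\<^bsub>UP K\<^esub> {?m}" by (intro P.genideal_self') simp
    ultimately show "p \<in> Idl\<^bsub>UP K\<^esub> {?m}"
      using ideal.I_r_closed[OF P.genideal_ideal, of "{?m}" ?m q] qc by simp
  qed
  ultimately have I_eq: "Idl\<^bsub>UP K\<^esub> {?m} = I" by blast
  have I: "ideal I (UP K)" by fact
  show ?thesis unfolding I_eq
  proof (rule not_quasi_hereditary_image_quot[OF I f, of N])
    show "N \<subseteq> carrier (UP K)" by (auto simp: N_def)
    show "(a \<otimes>\<^bsub>UP K\<^esub> b) \<otimes>\<^bsub>UP K\<^esub> (c \<otimes>\<^bsub>UP K\<^esub> d) \<in> I" if "a \<in> N" "b \<in> N" "c \<in> N" "d \<in> N" for a b c d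
      using that by (auto simp: N_def I_def C0 C1[unfolded One_nat_def] Cc)
    fix y assume y: "y \<in> carrier (UP K)" "y \<notin> N"
    \<comment> \<open>X takes the place of x_i: the linear coefficient of y X y is the square of the
      constant coefficient of y.\<close>
    let ?z = "up_ring.monom (UP K) \<one>\<^bsub>K\<^esub> 1"
    have z: "?z \<in> carrier (UP K)" "C ?z 0 = \<zero>\<^bsub>K\<^esub>" "C ?z 1 = \<one>\<^bsub>K\<^esub>" by (auto simp: C_def)
    have "y \<otimes>\<^bsub>UP K\<^esub> ?z \<otimes>\<^bsub>UP K\<^esub> y \<notin> I"
    proof
      assume "y \<otimes>\<^bsub>UP K\<^esub> ?z \<otimes>\<^bsub>UP K\<^esub> y \<in> I"
      then have "C y 0 \<otimes>\<^bsub>K\<^esub> C y 0 = \<zero>\<^bsub>K\<^esub>"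
        using y z by (simp add: I_def C0 C1[unfolded One_nat_def] Cc)
      then show False using y by (auto simp: N_def Cc K.integral_iff)
    qed
    moreover have "\<forall>r\<in>carrier (UP K). ?z \<otimes>\<^bsub>UP K\<^esub> r \<otimes>\<^bsub>UP K\<^esub> ?z \<in> I"
      using z by (auto simp: I_def C0 C1[unfolded One_nat_def] Cc)
    ultimately show "\<exists>z\<in>carrier (UP K). (\<forall>r\<in>carrier (UP K). z \<otimes>\<^bsub>UP K\<^esub> r \<otimes>\<^bsub>UP K\<^esub> z \<in> I) \<and>
        y \<otimes>\<^bsub>UP K\<^esub> z \<otimes>\<^bsub>UP K\<^esub> y \<notin> I" using z(1) by blast
  qed
qed

section \<open>Path algebras are rings\<close>

lemma (in abelian_monoid) finsum_eq_single:
  assumes "finite A" "i \<in> A" "\<And>j. j \<in> A \<Longrightarrow> j \<noteq> i \<Longrightarrow> f j = \<zero>" "f i \<in> carrier G"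
  shows "finsum G f A = f i"
proof -
  have "finsum G f A = (\<Oplus>j\<in>A. if i = j then f j else \<zero>)"
    using assms by (intro finsum_cong') auto
  also have "\<dots> = (\<Oplus>j\<in>A. if i = j then f i else \<zero>)"
    using assms by (intro finsum_cong') auto
  also have "\<dots> = f i"
    using assms add.finprod_singleton[of i A "\<lambda>_. f i"] by simp
  finally show ?thesis .
qed

text \<open>Both sides run over the pairs m \<le> n \<le> k, the right one with n = m + l. With m
  and n as cut points of a path this is the interchange behind associativity.\<close>

lemma (in abelian_monoid) finsum_triangle:
  fixes F :: "nat \<Rightarrow> nat \<Rightarrow> 'a"
  assumes "\<And>m n. F m n \<in> carrier G"
  shows "(\<Oplus>n\<in>{..k}. \<Oplus>m\<in>{..n}. F m n) = (\<Oplus>m\<in>{..k}. \<Oplus>l\<in>{..k-m}. F m (m + l))"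
proof (induction k)
  case 0
  then show ?case using assms by simp
next
  case (Suc k)
  have "(\<Oplus>m\<in>{..k}. \<Oplus>l\<in>{..Suc k-m}. F m (m + l)) =
      (\<Oplus>m\<in>{..k}. F m (Suc k) \<oplus> (\<Oplus>l\<in>{..k-m}. F m (m + l)))"
    using assms by (intro finsum_cong') (auto simp: Suc_diff_le)
  also have "\<dots> = (\<Oplus>m\<in>{..k}. F m (Suc k)) \<oplus> (\<Oplus>n\<in>{..k}. \<Oplus>m\<in>{..n}. F m n)"
    using assms by (simp add: Suc.IH finsum_addf)
  finally show ?case using assms by (simp add: a_assoc)
qed

text \<open>Finitely many vertices give the unit finite support; finitely many arcs make the sets of
  closed paths of length two finite, where \<open>finsum\<close> would otherwise return its default
  value.\<close>

locale quiver_algebra = ring K + fin_digraph Q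
  for K :: "('k, 'm) ring_scheme" (structure) and Q :: "('a, 'b) pre_digraph"
begin

abbreviation A where "A \<equiv> path_algebra K Q"

text \<open>The end of a walk is determined by its start and its arcs. Trading the existential
  endpoint for \<open>awlast\<close> lets concatenations be checked piece by piece.\<close>

lemma path_iff: "(u, p) \<in> quiver_paths Q \<longleftrightarrow> awalk u p (awlast u p)"
  by (auto simp: quiver_paths_def)

lemma path_append_iff:
  "(u, p @ q) \<in> quiver_paths Q \<longleftrightarrow> (u, p) \<in> quiver_paths Q \<and> (awlast u p, q) \<in> quiver_paths Q"
  by (simp add: path_iff awalk_append_iff awlast_append)

lemma in_carrier_iff:
  "f \<in> carrier A \<longleftrightarrow> (\<forall>w. f w \<in> carrier K) \<and> (\<forall>w. f w \<noteq> \<zero> \<longrightarrow> w \<in> quiver_paths Q) \<and>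
     finite {w. f w \<noteq> \<zero>}"
  by (auto simp: path_algebra_def)

lemma coeff_closed [simp]: "f \<in> carrier A \<Longrightarrow> f w \<in> carrier K"
  unfolding in_carrier_iff by blast

lemma coeff_path: "f \<in> carrier A \<Longrightarrow> f w \<noteq> \<zero> \<Longrightarrow> w \<in> quiver_paths Q"
  unfolding in_carrier_iff by blast

lemma finite_support: "f \<in> carrier A \<Longrightarrow> finite {w. f w \<noteq> \<zero>}"
  unfolding in_carrier_iff by blast

lemma coeff_mult:
  "(f \<otimes>\<^bsub>A\<^esub> g) (u, p) =
     (\<Oplus>n\<in>{..length p}. f (u, take n p) \<otimes> g (awlast u (take n p), drop n p))"
  by (simp add: path_algebra_def)

lemma coeff_add: "(f \<oplus>\<^bsub>A\<^esub> g) w = f w \<oplus> g w"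
  by (simp add: path_algebra_def)

lemma coeff_zero: "\<zero>\<^bsub>A\<^esub> w = \<zero>"
  by (simp add: path_algebra_def)

lemma coeff_one: "\<one>\<^bsub>A\<^esub> (u, p) = (if u \<in> verts Q \<and> p = [] then \<one> else \<zero>)"
  by (simp add: path_algebra_def)

lemma coeff_mult_nonzeroE:
  assumes f: "f \<in> carrier A" and g: "g \<in> carrier A" and nz: "(f \<otimes>\<^bsub>A\<^esub> g) (u, p) \<noteq> \<zero>"
  obtains q r where "p = q @ r" "f (u, q) \<noteq> \<zero>" "g (awlast u q, r) \<noteq> \<zero>"
proof -
  have "\<exists>n\<in>{..length p}. f (u, take n p) \<otimes> g (awlast u (take n p), drop n p) \<noteq> \<zero>"
  proof (rule ccontr)
    assume "\<not> ?thesis"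
    then have "(f \<otimes>\<^bsub>A\<^esub> g) (u, p) = (\<Oplus>n\<in>{..length p}. \<zero>)"
      unfolding coeff_mult by (intro finsum_cong') auto
    then show False using nz by simp
  qed
  then obtain n where n: "f (u, take n p) \<otimes> g (awlast u (take n p), drop n p) \<noteq> \<zero>" by blast
  then have "f (u, take n p) \<noteq> \<zero>" "g (awlast u (take n p), drop n p) \<noteq> \<zero>"
    using f g by auto
  then show thesis using that[of "take n p" "drop n p"] by simp
qed

lemma mult_closed:
  assumes f: "f \<in> carrier A" and g: "g \<in> carrier A"
  shows "f \<otimes>\<^bsub>A\<^esub> g \<in> carrier A"
  unfolding in_carrier_iff
proof (intro conjI allI impI)
  fix w :: "'a \<times> 'b list"
  obtain u p where w: "w = (u, p)" by force
  show "(f \<otimes>\<^bsub>A\<^esub> g) w \<in> carrier K"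
    using f g by (auto simp: w coeff_mult)
  assume "(f \<otimes>\<^bsub>A\<^esub> g) w \<noteq> \<zero>"
  then show "w \<in> quiver_paths Q"
    unfolding w by (rule coeff_mult_nonzeroE[OF f g]) (simp add: path_append_iff coeff_path[OF f] coeff_path[OF g])
next
  let ?S = "(\<lambda>((u, p), (v, q)). (u, p @ q)) ` ({w. f w \<noteq> \<zero>} \<times> {w. g w \<noteq> \<zero>})"
  have "{w. (f \<otimes>\<^bsub>A\<^esub> g) w \<noteq> \<zero>} \<subseteq> ?S"
  proof
    fix w assume "w \<in> {w. (f \<otimes>\<^bsub>A\<^esub> g) w \<noteq> \<zero>}"
    moreover obtain u p where w: "w = (u, p)" by force
    ultimately have "(f \<otimes>\<^bsub>A\<^esub> g) (u, p) \<noteq> \<zero>" by simp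
    then obtain q r where "p = q @ r" "f (u, q) \<noteq> \<zero>" "g (awlast u q, r) \<noteq> \<zero>"
      by (rule coeff_mult_nonzeroE[OF f g])
    then show "w \<in> ?S" unfolding w
      by (intro rev_image_eqI[of "((u, q), (awlast u q, r))"]) auto
  qed
  moreover have "finite ?S"
    by (intro finite_imageI finite_cartesian_product finite_support f g)
  ultimately show "finite {w. (f \<otimes>\<^bsub>A\<^esub> g) w \<noteq> \<zero>}" by (rule finite_subset)
qed

lemma mult_assoc:
  assumes f: "f \<in> carrier A" and g: "g \<in> carrier A" and h: "h \<in> carrier A"
  shows "(f \<otimes>\<^bsub>A\<^esub> g) \<otimes>\<^bsub>A\<^esub> h = f \<otimes>\<^bsub>A\<^esub> (g \<otimes>\<^bsub>A\<^esub> h)"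
proof
  fix w :: "'a \<times> 'b list"
  obtain u p where w: "w = (u, p)" by force
  \<comment> \<open>The contribution of cutting \<open>p\<close> into three pieces at the positions
    m \<le> n.\<close>
  define F where "F m n = f (u, take m p) \<otimes> g (awlast u (take m p), drop m (take n p)) \<otimes>
    h (awlast u (take n p), drop n p)" for m n
  have F: "F m n \<in> carrier K" for m n using f g h by (simp add: F_def)
  have "((f \<otimes>\<^bsub>A\<^esub> g) \<otimes>\<^bsub>A\<^esub> h) (u, p) = (\<Oplus>n\<in>{..length p}. \<Oplus>m\<in>{..n}. F m n)"
    unfolding coeff_mult[of "f \<otimes>\<^bsub>A\<^esub> g"]
  proof (intro finsum_cong')
    fix n assume n: "n \<in> {..length p}"
    have "(f \<otimes>\<^bsub>A\<^esub> g) (u, take n p) =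
        (\<Oplus>m\<in>{..n}. f (u, take m p) \<otimes> g (awlast u (take m p), drop m (take n p)))"
      unfolding coeff_mult using n f g by (intro finsum_cong') (auto simp: min_def)
    then show "(f \<otimes>\<^bsub>A\<^esub> g) (u, take n p) \<otimes> h (awlast u (take n p), drop n p) = (\<Oplus>m\<in>{..n}. F m n)"
      using f g h by (simp add: F_def finsum_ldistr Pi_def)
  qed (use F in auto)
  also have "\<dots> = (\<Oplus>m\<in>{..length p}. \<Oplus>l\<in>{..length p-m}. F m (m + l))"
    by (rule finsum_triangle[OF F])
  also have "\<dots> = (f \<otimes>\<^bsub>A\<^esub> (g \<otimes>\<^bsub>A\<^esub> h)) (u, p)"
    unfolding coeff_mult[of f]
  proof (rule sym, intro finsum_cong')
    fix m assume m: "m \<in> {..length p}"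
    let ?v = "awlast u (take m p)"
    have "g (?v, take l (drop m p)) \<otimes> h (awlast ?v (take l (drop m p)), drop l (drop m p)) =
        g (?v, drop m (take (m + l) p)) \<otimes> h (awlast u (take (m + l) p), drop (m + l) p)" for l
    proof -
      have "take l (drop m p) = drop m (take (m + l) p)" by (simp add: drop_take)
      moreover have "awlast ?v (take l (drop m p)) = awlast u (take (m + l) p)"
        by (simp only: take_add awlast_append)
      ultimately show ?thesis by (simp add: add.commute)
    qed
    then have "(g \<otimes>\<^bsub>A\<^esub> h) (?v, drop m p) =
      (\<Oplus>l\<in>{..length p-m}. g (?v, drop m (take (m + l) p)) \<otimes> h (awlast u (take (m + l) p), drop (m + l) p))"
      unfolding coeff_mult by simp
    then show "f (u, take m p) \<otimes> (g \<otimes>\<^bsub>A\<^esub> h) (?v, drop m p) = (\<Oplus>l\<in>{..length p-m}. F m (m + l))"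
      using f g h by (simp add: F_def finsum_rdistr Pi_def m_assoc)
  qed (use F in auto)
  finally show "((f \<otimes>\<^bsub>A\<^esub> g) \<otimes>\<^bsub>A\<^esub> h) w = (f \<otimes>\<^bsub>A\<^esub> (g \<otimes>\<^bsub>A\<^esub> h)) w" by (simp add: w)
qed

lemma add_closed:
  assumes f: "f \<in> carrier A" and g: "g \<in> carrier A"
  shows "f \<oplus>\<^bsub>A\<^esub> g \<in> carrier A"
proof -
  have "{w. (f \<oplus>\<^bsub>A\<^esub> g) w \<noteq> \<zero>} \<subseteq> {w. f w \<noteq> \<zero>} \<union> {w. g w \<noteq> \<zero>}"
    by (auto simp: coeff_add)
  moreover have "finite \<dots>" using finite_support[OF f] finite_support[OF g] by simp
  ultimately have "finite {w. (f \<oplus>\<^bsub>A\<^esub> g) w \<noteq> \<zero>}" by (rule finite_subset)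
  moreover have "w \<in> quiver_paths Q" if "(f \<oplus>\<^bsub>A\<^esub> g) w \<noteq> \<zero>" for w
    using that coeff_path[OF f, of w] coeff_path[OF g, of w] by (cases "f w = \<zero>") (auto simp: g coeff_add)
  moreover have "(f \<oplus>\<^bsub>A\<^esub> g) w \<in> carrier K" for w using f g by (simp add: coeff_add)
  ultimately show ?thesis unfolding in_carrier_iff by blast
qed

lemma one_in_carrier: "\<one>\<^bsub>A\<^esub> \<in> carrier A"
  unfolding in_carrier_iff
proof (intro conjI allI impI)
  fix w :: "'a \<times> 'b list"
  obtain u p where w: "w = (u, p)" by force
  show "\<one>\<^bsub>A\<^esub> w \<in> carrier K" by (simp add: w coeff_one)
  assume "\<one>\<^bsub>A\<^esub> w \<noteq> \<zero>"
  then have "u \<in> verts Q" "p = []" by (simp_all add: w coeff_one split: if_splits)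
  then show "w \<in> quiver_paths Q" by (simp add: w path_iff awalk_Nil_iff)
next
  have "{w. \<one>\<^bsub>A\<^esub> w \<noteq> \<zero>} \<subseteq> (\<lambda>u. (u, [])) ` verts Q"
  proof
    fix w assume "w \<in> {w. \<one>\<^bsub>A\<^esub> w \<noteq> \<zero>}"
    moreover obtain u p where w: "w = (u, p)" by force
    ultimately have "u \<in> verts Q" "p = []" by (simp_all add: coeff_one split: if_splits)
    then show "w \<in> (\<lambda>u. (u, [])) ` verts Q" by (simp add: w)
  qed
  then show "finite {w. \<one>\<^bsub>A\<^esub> w \<noteq> \<zero>}" by (rule finite_subset) simp
qed

lemma ring_path_algebra: "ring A"
proof (rule ringI)
  show "abelian_group A"
  proof (rule abelian_groupI)
    fix f assume f: "f \<in> carrier A"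
    have "(\<lambda>w. \<ominus> f w) \<in> carrier A"
    proof -
      have inv0: "\<ominus> x = \<zero> \<longleftrightarrow> x = \<zero>" if "x \<in> carrier K" for x
      proof
        assume "\<ominus> x = \<zero>"
        then have "\<ominus> (\<ominus> x) = \<zero>" by simp
        then show "x = \<zero>" using that by simp
      qed simp
      show ?thesis unfolding in_carrier_iff
      proof (intro conjI allI impI)
        fix w
        show "\<ominus> f w \<in> carrier K" using f by simp
        assume "\<ominus> f w \<noteq> \<zero>"
        then show "w \<in> quiver_paths Q" using f inv0 by (intro coeff_path[OF f]) simp
      next
        show "finite {w. \<ominus> f w \<noteq> \<zero>}" using finite_support[OF f] f inv0 by simp
      qed
    qed
    moreover have "(\<lambda>w. \<ominus> f w) \<oplus>\<^bsub>A\<^esub> f = \<zero>\<^bsub>A\<^esub>"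
      using f by (intro ext) (simp add: coeff_add coeff_zero l_neg)
    ultimately show "\<exists>g\<in>carrier A. g \<oplus>\<^bsub>A\<^esub> f = \<zero>\<^bsub>A\<^esub>" by blast
  qed (auto intro!: ext simp: add_closed coeff_add coeff_zero a_ac in_carrier_iff[of "\<zero>\<^bsub>A\<^esub>"])
  show "monoid A"
  proof (rule monoidI)
    show "\<one>\<^bsub>A\<^esub> \<in> carrier A" by (rule one_in_carrier)
    fix f assume f: "f \<in> carrier A"
    \<comment> \<open>The unit has coefficients at vertices only, so multiplying by it erases every
      coefficient whose start or end is not a vertex; these must be zero beforehand.\<close>
    have outside: "f (u, p) = \<zero>" if "u \<notin> verts Q \<or> awlast u p \<notin> verts Q" for u p
      using that coeff_path[OF f, of "(u, p)"] by (auto simp: path_iff)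
    show "\<one>\<^bsub>A\<^esub> \<otimes>\<^bsub>A\<^esub> f = f"
    proof
      fix w :: "'a \<times> 'b list"
      obtain u p where w: "w = (u, p)" by force
      have "(\<one>\<^bsub>A\<^esub> \<otimes>\<^bsub>A\<^esub> f) (u, p) = \<one>\<^bsub>A\<^esub> (u, take 0 p) \<otimes> f (awlast u (take 0 p), drop 0 p)"
        unfolding coeff_mult using f by (intro finsum_eq_single) (auto simp: coeff_one)
      also have "\<dots> = f (u, p)"
        using f outside by (cases "u \<in> verts Q") (simp_all add: coeff_one)
      finally show "(\<one>\<^bsub>A\<^esub> \<otimes>\<^bsub>A\<^esub> f) w = f w" by (simp add: w)
    qed
    show "f \<otimes>\<^bsub>A\<^esub> \<one>\<^bsub>A\<^esub> = f"
    proof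
      fix w :: "'a \<times> 'b list"
      obtain u p where w: "w = (u, p)" by force
      have "(f \<otimes>\<^bsub>A\<^esub> \<one>\<^bsub>A\<^esub>) (u, p) =
          f (u, take (length p) p) \<otimes> \<one>\<^bsub>A\<^esub> (awlast u (take (length p) p), drop (length p) p)"
        unfolding coeff_mult using f by (intro finsum_eq_single) (auto simp: coeff_one)
      also have "\<dots> = f (u, p)"
        using f outside by (cases "awlast u p \<in> verts Q") (simp_all add: coeff_one)
      finally show "(f \<otimes>\<^bsub>A\<^esub> \<one>\<^bsub>A\<^esub>) w = f w" by (simp add: w)
    qed
  qed (auto simp: mult_closed mult_assoc)
next
  fix f g h assume f: "f \<in> carrier A" and g: "g \<in> carrier A" and h: "h \<in> carrier A"
  show "(f \<oplus>\<^bsub>A\<^esub> g) \<otimes>\<^bsub>A\<^esub> h = f \<otimes>\<^bsub>A\<^esub> h \<oplus>\<^bsub>A\<^esub> g \<otimes>\<^bsub>A\<^esub> h"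
  proof
    fix w :: "'a \<times> 'b list"
    obtain u p where w: "w = (u, p)" by force
    show "((f \<oplus>\<^bsub>A\<^esub> g) \<otimes>\<^bsub>A\<^esub> h) w = (f \<otimes>\<^bsub>A\<^esub> h \<oplus>\<^bsub>A\<^esub> g \<otimes>\<^bsub>A\<^esub> h) w"
      using f g h by (simp add: w coeff_mult coeff_add l_distr finsum_addf Pi_def)
  qed
  show "h \<otimes>\<^bsub>A\<^esub> (f \<oplus>\<^bsub>A\<^esub> g) = h \<otimes>\<^bsub>A\<^esub> f \<oplus>\<^bsub>A\<^esub> h \<otimes>\<^bsub>A\<^esub> g"
  proof
    fix w :: "'a \<times> 'b list"
    obtain u p where w: "w = (u, p)" by force
    show "(h \<otimes>\<^bsub>A\<^esub> (f \<oplus>\<^bsub>A\<^esub> g)) w = (h \<otimes>\<^bsub>A\<^esub> f \<oplus>\<^bsub>A\<^esub> h \<otimes>\<^bsub>A\<^esub> g) w"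
      using f g h by (simp add: w coeff_mult coeff_add r_distr finsum_addf Pi_def)
  qed
qed

sublocale A: ring A by (rule ring_path_algebra)

lemma coeff_a_inv:
  assumes f: "f \<in> carrier A"
  shows "(\<ominus>\<^bsub>A\<^esub> f) w = \<ominus> f w"
proof -
  have "(\<ominus>\<^bsub>A\<^esub> f) w \<oplus> f w = \<zero>" using A.l_neg[OF f] by (metis coeff_add coeff_zero)
  then show ?thesis using f minus_equality by simp
qed

subsection \<open>The filtration by path length\<close>

text \<open>A scalar multiple of a path. The path algebra is only a ring record, so scaling is
  imitated by multiplying with such a term at a path of length zero.\<close>

definition path_term :: "'k \<Rightarrow> 'a \<Rightarrow> 'b list \<Rightarrow> 'a \<times> 'b list \<Rightarrow> 'k" where
  "path_term c u p = (\<lambda>w. if w = (u, p) then c else \<zero>)"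

lemma path_term_closed:
  assumes "c \<in> carrier K" "(u, p) \<in> quiver_paths Q"
  shows "path_term c u p \<in> carrier A"
proof -
  have "{w. path_term c u p w \<noteq> \<zero>} \<subseteq> {(u, p)}" by (auto simp: path_term_def)
  then have "finite {w. path_term c u p w \<noteq> \<zero>}" by (rule finite_subset) simp
  then show ?thesis using assms by (auto simp: in_carrier_iff path_term_def)
qed

lemma path_term_mult:
  assumes "c \<in> carrier K" "d \<in> carrier K"
  shows "path_term c u p \<otimes>\<^bsub>A\<^esub> path_term d (awlast u p) q = path_term (c \<otimes> d) u (p @ q)"
proof
  fix w :: "'a \<times> 'b list"
  obtain v r where w: "w = (v, r)" by force
  have zero: "path_term c u p (v, take n r) \<otimes> path_term d (awlast u p) q (awlast v (take n r), drop n r) = \<zero>"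
    if "(v, r) \<noteq> (u, p @ q) \<or> n \<noteq> length p" "n \<in> {..length r}" for n
  proof -
    have "\<not> (v = u \<and> take n r = p \<and> drop n r = q)"
      using that append_take_drop_id[of n r] by auto
    then show ?thesis using assms by (auto simp: path_term_def)
  qed
  show "(path_term c u p \<otimes>\<^bsub>A\<^esub> path_term d (awlast u p) q) w = path_term (c \<otimes> d) u (p @ q) w"
  proof (cases "(v, r) = (u, p @ q)")
    case True
    have "(path_term c u p \<otimes>\<^bsub>A\<^esub> path_term d (awlast u p) q) (v, r) = path_term c u p (v, take (length p) r) \<otimes>
        path_term d (awlast u p) q (awlast v (take (length p) r), drop (length p) r)"
      unfolding coeff_mult using assms True zero
      by (intro finsum_eq_single) (auto simp: path_term_def)
    then show ?thesis using True by (simp add: w path_term_def)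
  next
    case False
    have "(path_term c u p \<otimes>\<^bsub>A\<^esub> path_term d (awlast u p) q) (v, r) = (\<Oplus>n\<in>{..length r}. \<zero>)"
      unfolding coeff_mult using False zero by (intro finsum_cong') auto
    moreover have "path_term (c \<otimes> d) u (p @ q) (v, r) = \<zero>" using False by (auto simp: path_term_def)
    ultimately show ?thesis by (simp add: w)
  qed
qed

text \<open>The n-th power of the arrow ideal, the whole algebra for n = 0.\<close>

definition length_ge :: "nat \<Rightarrow> ('a \<times> 'b list \<Rightarrow> 'k) set" where
  "length_ge n = {f \<in> carrier A. \<forall>u p. length p < n \<longrightarrow> f (u, p) = \<zero>}"

lemma length_ge_mult:
  assumes "f \<in> length_ge m" "g \<in> length_ge n"
  shows "f \<otimes>\<^bsub>A\<^esub> g \<in> length_ge (m + n)"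
proof -
  have "(f \<otimes>\<^bsub>A\<^esub> g) (u, p) = \<zero>" if "length p < m + n" for u p
  proof (rule ccontr)
    assume "(f \<otimes>\<^bsub>A\<^esub> g) (u, p) \<noteq> \<zero>"
    then obtain q r where p: "p = q @ r" and nz: "f (u, q) \<noteq> \<zero>" "g (awlast u q, r) \<noteq> \<zero>"
      using coeff_mult_nonzeroE assms by (metis (no_types, lifting) length_ge_def mem_Collect_eq)
    have "m \<le> length q" using assms(1) nz(1) by (auto simp: length_ge_def not_less[symmetric])
    moreover have "n \<le> length r" using assms(2) nz(2) by (auto simp: length_ge_def not_less[symmetric])
    ultimately show False using that p by simp
  qed
  then show ?thesis using assms mult_closed by (simp add: length_ge_def)
qed

text \<open>As \<open>f\<close> has no coefficients at paths shorter than \<open>p\<close>, the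
  piece of \<open>p\<close> taken from \<open>f\<close> is all of \<open>p\<close>, and a path of
  length zero is left for \<open>g\<close>.\<close>

lemma length_ge_coeff_mult:
  assumes f: "f \<in> length_ge (length p)" and g: "g \<in> carrier A"
  shows "(f \<otimes>\<^bsub>A\<^esub> g) (u, p) = f (u, p) \<otimes> g (awlast u p, [])"
    and "(g \<otimes>\<^bsub>A\<^esub> f) (u, p) = g (u, []) \<otimes> f (u, p)"
proof -
  have fc: "f \<in> carrier A" and f0: "\<And>u q. length q < length p \<Longrightarrow> f (u, q) = \<zero>"
    using f by (auto simp: length_ge_def)
  have "(f \<otimes>\<^bsub>A\<^esub> g) (u, p) =
      f (u, take (length p) p) \<otimes> g (awlast u (take (length p) p), drop (length p) p)"
    unfolding coeff_mult using fc g f0 by (intro finsum_eq_single) auto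
  then show "(f \<otimes>\<^bsub>A\<^esub> g) (u, p) = f (u, p) \<otimes> g (awlast u p, [])" by simp
  have "(g \<otimes>\<^bsub>A\<^esub> f) (u, p) =
      g (u, take 0 p) \<otimes> f (awlast u (take 0 p), drop 0 p)"
    unfolding coeff_mult using fc g f0 by (intro finsum_eq_single) auto
  then show "(g \<otimes>\<^bsub>A\<^esub> f) (u, p) = g (u, []) \<otimes> f (u, p)" by simp
qed

text \<open>A longer path is absorbed by the ideal because its first n arcs already form a member. A
  general element is a finite combination of such paths, which are removed one at a time by
  induction on a finite set containing the support.\<close>

lemma length_ge_subset_ideal:
  assumes I: "ideal I A"
    and paths: "\<And>u p. (u, p) \<in> quiver_paths Q \<Longrightarrow> length p = n \<Longrightarrow> path_term \<one> u p \<in> I"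
  shows "length_ge n \<subseteq> I"
proof -
  interpret I: ideal I A by (rule I)
  have mono: "path_term c u p \<in> I" if c: "c \<in> carrier K" and p: "(u, p) \<in> quiver_paths Q" "n \<le> length p" for c u p
  proof -
    let ?q = "take n p" let ?r = "drop n p" let ?v = "awlast u (take n p)"
    have path: "(u, ?q) \<in> quiver_paths Q" "(?v, ?r) \<in> quiver_paths Q" "(u, []) \<in> quiver_paths Q"
      using p path_append_iff[of u ?q ?r] path_append_iff[of u "[]" p] by auto
    \<comment> \<open>The hypothesis covers coefficient 1 only; the scalar \<open>c\<close> enters
      through the path of length zero at \<open>u\<close>.\<close>
    have "path_term c u [] \<otimes>\<^bsub>A\<^esub> path_term \<one> u ?q = path_term c u ?q"
      using path_term_mult[OF c, of \<one> u "[]" ?q] c by simp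
    then have "path_term c u ?q \<in> I"
      using paths[of u ?q] p path I.I_l_closed[of "path_term \<one> u ?q" "path_term c u []"] path_term_closed[OF c path(3)]
      by simp
    then have "path_term c u ?q \<otimes>\<^bsub>A\<^esub> path_term \<one> ?v ?r \<in> I"
      using path by (intro I.I_r_closed path_term_closed) auto
    then show ?thesis using path_term_mult[OF c, of \<one> u ?q ?r] c by simp
  qed
  have "f \<in> I" if "finite S" "f \<in> length_ge n" "{w. f w \<noteq> \<zero>} \<subseteq> S" for f S
    using that
  proof (induction S arbitrary: f rule: finite_induct)
    case empty
    then have "f = \<zero>\<^bsub>A\<^esub>" by (intro ext) (auto simp: coeff_zero)
    then show ?case by (simp only: I.zero_closed)
  next
    case (insert w S)
    have fc: "f \<in> carrier A" and f0: "\<And>u p. length p < n \<Longrightarrow> f (u, p) = \<zero>"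
      using insert.prems by (auto simp: length_ge_def)
    obtain u p where w: "w = (u, p)" by force
    show ?case
    proof (cases "f w = \<zero>")
      case True
      then have "{w. f w \<noteq> \<zero>} \<subseteq> S" using insert.prems by auto
      then show ?thesis using insert by blast
    next
      case False
      then have p: "(u, p) \<in> quiver_paths Q" "n \<le> length p"
        using coeff_path[OF fc] f0[of p u] by (auto simp: w not_less[symmetric])
      define t where "t = path_term (f w) u p"
      have t: "t \<in> I" using fc p by (auto simp: t_def intro!: mono)
      have tc: "t \<in> carrier A" using t I.Icarr by auto
      define g where "g = f \<ominus>\<^bsub>A\<^esub> t"
      have gc: "g \<in> carrier A" using fc tc by (simp add: g_def)
      have g: "g v = (if v = w then \<zero> else f v)" for v
        using fc tc by (simp add: g_def A.minus_eq coeff_add coeff_a_inv) (simp add: t_def path_term_def w r_neg)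
      have "{w. g w \<noteq> \<zero>} \<subseteq> S" using insert.prems by (auto simp: g)
      moreover have "g \<in> length_ge n" using f0 gc by (auto simp: length_ge_def g)
      ultimately have "g \<in> I" by (intro insert.IH)
      moreover have "f = g \<oplus>\<^bsub>A\<^esub> t" using fc tc by (simp add: g_def A.minus_eq A.a_assoc A.l_neg)
      ultimately show ?thesis using t by simp
    qed
  qed
  then show ?thesis using finite_support by (auto simp: length_ge_def)
qed

subsection \<open>Sums over closed paths of length two\<close>

definition two_loops :: "'a \<Rightarrow> 'b list set" where
  "two_loops i = {p. awalk i p i \<and> length p = 2}"

definition loop_sum :: "'a \<Rightarrow> ('a \<times> 'b list \<Rightarrow> 'k) \<Rightarrow> 'k" where
  "loop_sum i f = (\<Oplus>p\<in>two_loops i. f (i, p))"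

lemma finite_two_loops: "finite (two_loops i)"
proof -
  have "two_loops i \<subseteq> {p. set p \<subseteq> arcs Q \<and> length p = 2}"
    by (auto simp: two_loops_def awalk_def)
  then show ?thesis by (rule finite_subset) (intro finite_lists_length_eq finite_arcs)
qed

lemma loop_sum_closed [simp]: "f \<in> carrier A \<Longrightarrow> loop_sum i f \<in> carrier K"
  by (simp add: loop_sum_def Pi_def)

lemma loop_sum_add:
  "f \<in> carrier A \<Longrightarrow> g \<in> carrier A \<Longrightarrow> loop_sum i (f \<oplus>\<^bsub>A\<^esub> g) = loop_sum i f \<oplus> loop_sum i g"
  by (simp add: loop_sum_def coeff_add finsum_addf Pi_def)

lemma loop_sum_zero: "loop_sum i \<zero>\<^bsub>A\<^esub> = \<zero>"
  by (simp add: loop_sum_def coeff_zero)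

lemma loop_sum_a_inv:
  assumes f: "f \<in> carrier A"
  shows "loop_sum i (\<ominus>\<^bsub>A\<^esub> f) = \<ominus> loop_sum i f"
proof -
  have "loop_sum i (\<ominus>\<^bsub>A\<^esub> f) \<oplus> loop_sum i f = \<zero>"
    using loop_sum_add[of "\<ominus>\<^bsub>A\<^esub> f" f i] f by (simp add: A.l_neg loop_sum_zero)
  then show ?thesis using f minus_equality by simp
qed

text \<open>A closed path at \<open>i\<close> starts and ends at \<open>i\<close>, so every summand
  picks up the same factor, the coefficient of \<open>g\<close> at the path of length zero at
  \<open>i\<close>. This is what makes \<open>loop_kernel\<close> a two-sided ideal, and applied on
  both sides it produces the square of a coefficient.\<close>

lemma loop_sum_mult:
  assumes f: "f \<in> length_ge 2" and g: "g \<in> carrier A"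
  shows "loop_sum i (f \<otimes>\<^bsub>A\<^esub> g) = loop_sum i f \<otimes> g (i, [])"
    and "loop_sum i (g \<otimes>\<^bsub>A\<^esub> f) = g (i, []) \<otimes> loop_sum i f"
proof -
  have fc: "f \<in> carrier A" using f by (simp add: length_ge_def)
  have "(f \<otimes>\<^bsub>A\<^esub> g) (i, p) = f (i, p) \<otimes> g (i, [])" "(g \<otimes>\<^bsub>A\<^esub> f) (i, p) = g (i, []) \<otimes> f (i, p)"
    if "p \<in> two_loops i" for p
  proof -
    have p: "f \<in> length_ge (length p)" "awlast i p = i" using that f by (auto simp: two_loops_def)
    show "(f \<otimes>\<^bsub>A\<^esub> g) (i, p) = f (i, p) \<otimes> g (i, [])" "(g \<otimes>\<^bsub>A\<^esub> f) (i, p) = g (i, []) \<otimes> f (i, p)"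
      using length_ge_coeff_mult[OF p(1) g, of i] p(2) by simp_all
  qed
  then have "loop_sum i (f \<otimes>\<^bsub>A\<^esub> g) = (\<Oplus>p\<in>two_loops i. f (i, p) \<otimes> g (i, []))"
    "loop_sum i (g \<otimes>\<^bsub>A\<^esub> f) = (\<Oplus>p\<in>two_loops i. g (i, []) \<otimes> f (i, p))"
    unfolding loop_sum_def using fc g by (auto intro!: finsum_cong')
  then show "loop_sum i (f \<otimes>\<^bsub>A\<^esub> g) = loop_sum i f \<otimes> g (i, [])"
    "loop_sum i (g \<otimes>\<^bsub>A\<^esub> f) = g (i, []) \<otimes> loop_sum i f"
    using finite_two_loops fc g by (simp_all add: loop_sum_def finsum_ldistr finsum_rdistr Pi_def)
qed

lemma loop_sum_path_term:
  assumes c: "c \<in> carrier K"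
  shows "loop_sum j (path_term c i p) = (if j = i \<and> p \<in> two_loops i then c else \<zero>)"
proof (cases "j = i \<and> p \<in> two_loops i")
  case True
  then have "loop_sum j (path_term c i p) = path_term c i p (j, p)"
    unfolding loop_sum_def using c
    by (intro finsum_eq_single) (auto simp: finite_two_loops path_term_def)
  then show ?thesis using True by (simp add: path_term_def)
next
  case False
  then have "loop_sum j (path_term c i p) = (\<Oplus>q\<in>two_loops j. \<zero>)"
    unfolding loop_sum_def by (intro finsum_cong') (auto simp: path_term_def)
  then show ?thesis by (simp only: False if_False finsum_zero)
qed

text \<open>A common upper bound for the ideals of relations on two and on more vertices. Paths of
  length two with distinct ends are seen by no loop sum, in keeping with their being zero in the
  zigzag algebra.\<close>

definition loop_kernel :: "('a \<times> 'b list \<Rightarrow> 'k) set" where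
  "loop_kernel = {f \<in> length_ge 2. \<forall>i. loop_sum i f = \<zero>}"

lemma length_ge_carrier: "f \<in> length_ge n \<Longrightarrow> f \<in> carrier A"
  by (simp add: length_ge_def)

lemma length_ge_add: "f \<in> length_ge n \<Longrightarrow> g \<in> length_ge n \<Longrightarrow> f \<oplus>\<^bsub>A\<^esub> g \<in> length_ge n"
  by (simp add: length_ge_def coeff_add add_closed)

lemma length_ge_a_inv: "f \<in> length_ge n \<Longrightarrow> \<ominus>\<^bsub>A\<^esub> f \<in> length_ge n"
  by (simp add: length_ge_def coeff_a_inv)

lemma length_ge_0: "length_ge 0 = carrier A"
  by (simp add: length_ge_def)

lemma length_ge_mono: "m \<le> n \<Longrightarrow> length_ge n \<subseteq> length_ge m"
  by (auto simp: length_ge_def)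

lemma path_term_length_ge:
  "c \<in> carrier K \<Longrightarrow> (u, p) \<in> quiver_paths Q \<Longrightarrow> path_term c u p \<in> length_ge (length p)"
  by (simp add: length_ge_def path_term_closed) (auto simp: path_term_def)

lemma ideal_loop_kernel: "ideal loop_kernel A"
proof (rule idealI)
  show "ring A" by (rule ring_path_algebra)
  show "subgroup loop_kernel (add_monoid A)"
  proof (rule A.add.subgroupI)
    show "loop_kernel \<subseteq> carrier A" by (auto simp: loop_kernel_def length_ge_carrier)
    have "\<zero>\<^bsub>A\<^esub> \<in> loop_kernel" by (simp add: loop_kernel_def length_ge_def loop_sum_zero coeff_zero)
    then show "loop_kernel \<noteq> {}" by blast
    fix f assume "f \<in> loop_kernel"
    then have f: "f \<in> length_ge 2" "\<And>i. loop_sum i f = \<zero>" "f \<in> carrier A"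
      by (auto simp: loop_kernel_def length_ge_carrier)
    then show "\<ominus>\<^bsub>A\<^esub> f \<in> loop_kernel"
      by (simp add: loop_kernel_def length_ge_a_inv loop_sum_a_inv)
    fix g assume "g \<in> loop_kernel"
    then have g: "g \<in> length_ge 2" "\<And>i. loop_sum i g = \<zero>" "g \<in> carrier A"
      by (auto simp: loop_kernel_def length_ge_carrier)
    with f show "f \<oplus>\<^bsub>A\<^esub> g \<in> loop_kernel"
      by (simp add: loop_kernel_def length_ge_add loop_sum_add)
  qed
next
  fix f x assume "f \<in> loop_kernel" and x: "x \<in> carrier A"
  then have f: "f \<in> length_ge 2" "\<And>i. loop_sum i f = \<zero>" by (auto simp: loop_kernel_def)
  show "x \<otimes>\<^bsub>A\<^esub> f \<in> loop_kernel"
    using length_ge_mult[of x 0 f 2] f x loop_sum_mult[OF f(1) x]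
    by (simp add: loop_kernel_def length_ge_0 numeral_2_eq_2)
  show "f \<otimes>\<^bsub>A\<^esub> x \<in> loop_kernel"
    using length_ge_mult[of f 2 x 0] f x loop_sum_mult[OF f(1) x]
    by (simp add: loop_kernel_def length_ge_0 numeral_2_eq_2)
qed

lemma length_ge_3_subset_loop_kernel: "length_ge 3 \<subseteq> loop_kernel"
proof
  fix f assume f: "f \<in> length_ge 3"
  then have "loop_sum i f = (\<Oplus>p\<in>two_loops i. \<zero>)" for i
    unfolding loop_sum_def by (intro finsum_cong') (auto simp: length_ge_def two_loops_def)
  then show "f \<in> loop_kernel"
    using f length_ge_mono[of 2 3] by (auto simp: loop_kernel_def)
qed

text \<open>Fourfold products of elements of \<open>length_ge 1\<close> and all products z r z start
  in length four, so the lower bound puts them into \<open>I\<close>. The upper bound reduces the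
  claim that y z y is outside \<open>I\<close> to a single nonzero loop sum.\<close>

lemma not_quasi_hereditary_path_algebra_quot:
  assumes K: "field K" and f: "inj f"
    and loops: "\<And>i. i \<in> verts Q \<Longrightarrow> two_loops i \<noteq> {}"
    and I: "ideal I A" "length_ge 3 \<subseteq> I" "I \<subseteq> loop_kernel"
  shows "\<not> quasi_hereditary (image_ring f (A Quot I))"
proof (rule not_quasi_hereditary_image_quot[OF I(1) f, of "length_ge 1"])
  show "length_ge 1 \<subseteq> carrier A" using length_ge_carrier by blast
  fix a b c d assume "a \<in> length_ge 1" "b \<in> length_ge 1" "c \<in> length_ge 1" "d \<in> length_ge 1"
  then have "(a \<otimes>\<^bsub>A\<^esub> b) \<otimes>\<^bsub>A\<^esub> (c \<otimes>\<^bsub>A\<^esub> d) \<in> length_ge ((1 + 1) + (1 + 1))"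
    by (intro length_ge_mult)
  then show "(a \<otimes>\<^bsub>A\<^esub> b) \<otimes>\<^bsub>A\<^esub> (c \<otimes>\<^bsub>A\<^esub> d) \<in> I"
    using I(2) length_ge_mono[of 3 "(1 + 1) + (1 + 1)"] by (auto simp del: One_nat_def)
next
  interpret K: field K by (rule K)
  fix y assume y: "y \<in> carrier A" "y \<notin> length_ge 1"
  then obtain u where u: "y (u, []) \<noteq> \<zero>" by (auto simp: length_ge_def)
  then have "u \<in> verts Q" using coeff_path[OF y(1), of "(u, [])"] by (simp add: path_iff awalk_Nil_iff)
  \<comment> \<open>Any closed path of length two can represent x_u, since each of them has loop sum
    1 at \<open>u\<close>.\<close>
  then obtain q where q: "q \<in> two_loops u" using loops by blast
  then have "(u, q) \<in> quiver_paths Q" "length q = 2" by (auto simp: two_loops_def path_iff)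
  then have z: "path_term \<one> u q \<in> length_ge 2" using path_term_length_ge[of \<one> u q] by simp
  have zc: "path_term \<one> u q \<in> carrier A" using z by (rule length_ge_carrier)
  have "path_term \<one> u q \<otimes>\<^bsub>A\<^esub> r \<otimes>\<^bsub>A\<^esub> path_term \<one> u q \<in> I" if "r \<in> carrier A" for r
  proof -
    have "path_term \<one> u q \<otimes>\<^bsub>A\<^esub> r \<otimes>\<^bsub>A\<^esub> path_term \<one> u q \<in> length_ge ((2 + 0) + 2)"
      using that z by (intro length_ge_mult) (simp_all add: length_ge_0)
    then show ?thesis using I(2) length_ge_mono[of 3 "(2 + 0) + 2"] by auto
  qed
  moreover have "y \<otimes>\<^bsub>A\<^esub> path_term \<one> u q \<otimes>\<^bsub>A\<^esub> y \<notin> I"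
  proof -
    have "y \<otimes>\<^bsub>A\<^esub> path_term \<one> u q \<in> length_ge 2"
      using length_ge_mult[of y 0 _ 2] y z by (simp add: length_ge_0 numeral_2_eq_2)
    then have "loop_sum u (y \<otimes>\<^bsub>A\<^esub> path_term \<one> u q \<otimes>\<^bsub>A\<^esub> y) = y (u, []) \<otimes> \<one> \<otimes> y (u, [])"
      using loop_sum_mult y z q by (simp add: loop_sum_path_term)
    also have "\<dots> \<noteq> \<zero>" using u y by (simp add: K.integral_iff)
    finally show ?thesis using I(3) by (auto simp: loop_kernel_def)
  qed
  ultimately show "\<exists>z\<in>carrier A. (\<forall>r\<in>carrier A. z \<otimes>\<^bsub>A\<^esub> r \<otimes>\<^bsub>A\<^esub> z \<in> I) \<and> y \<otimes>\<^bsub>A\<^esub> z \<otimes>\<^bsub>A\<^esub> y \<notin> I"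
    using zc by blast
qed

section \<open>The defining relations and the two bounds\<close>

lemma path_basis_eq: "path_basis K (u, p) = path_term \<one> u p"
  by (simp add: path_basis_def path_term_def)

lemma Idl_length_three_paths:
  shows "length_ge 3 \<subseteq> Idl\<^bsub>A\<^esub> (length_three_paths K Q)"
    and "Idl\<^bsub>A\<^esub> (length_three_paths K Q) \<subseteq> loop_kernel"
proof -
  have sub: "length_three_paths K Q \<subseteq> length_ge 3"
  proof
    fix f assume "f \<in> length_three_paths K Q"
    then obtain u p where "f = path_term \<one> u p" "(u, p) \<in> quiver_paths Q" "length p = 3"
      by (auto simp: length_three_paths_def path_basis_eq)
    then show "f \<in> length_ge 3" using path_term_length_ge[of \<one> u p] by simp
  qed
  then have c: "length_three_paths K Q \<subseteq> carrier A" using length_ge_carrier by blast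
  show "length_ge 3 \<subseteq> Idl\<^bsub>A\<^esub> (length_three_paths K Q)"
  proof (rule length_ge_subset_ideal)
    fix u p assume "(u, p) \<in> quiver_paths Q" "length p = 3"
    then have "path_term \<one> u p \<in> length_three_paths K Q"
      by (auto simp: length_three_paths_def path_basis_eq)
    then show "path_term \<one> u p \<in> Idl\<^bsub>A\<^esub> (length_three_paths K Q)"
      using A.genideal_self[OF c] by blast
  qed (rule A.genideal_ideal[OF c])
  show "Idl\<^bsub>A\<^esub> (length_three_paths K Q) \<subseteq> loop_kernel"
    by (intro A.genideal_minimal ideal_loop_kernel order.trans[OF sub length_ge_3_subset_loop_kernel])
qed

text \<open>A path with distinct ends belongs to no \<open>two_loops\<close>, and the two loops of a
  difference have equal loop sums: 1 at their common vertex and 0 elsewhere.\<close>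

lemma zigzag_relations_subset: "zigzag_relations K Q \<subseteq> loop_kernel"
proof -
  have "path_term \<one> i [a, b] \<in> loop_kernel" if w: "awalk i [a, b] k" "i \<noteq> k" for i a b k
  proof -
    have "(i, [a, b]) \<in> quiver_paths Q" using w by (auto simp: quiver_paths_def)
    then have "path_term \<one> i [a, b] \<in> length_ge 2"
      using path_term_length_ge[of \<one> i "[a, b]"] by (simp add: numeral_2_eq_2)
    moreover have "[a, b] \<notin> two_loops i" using w by (auto simp: two_loops_def awalk_def)
    ultimately show ?thesis by (simp add: loop_kernel_def loop_sum_path_term)
  qed
  moreover have "path_term \<one> i [a, b] \<ominus>\<^bsub>A\<^esub> path_term \<one> i [c, d] \<in> loop_kernel"
    if w: "awalk i [a, b] i" "awalk i [c, d] i" for i a b c d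
  proof -
    have "(i, [a, b]) \<in> quiver_paths Q" "(i, [c, d]) \<in> quiver_paths Q"
      using w by (auto simp: quiver_paths_def)
    then have len: "path_term \<one> i [a, b] \<in> length_ge 2" "path_term \<one> i [c, d] \<in> length_ge 2"
      using path_term_length_ge[of \<one> i "[a, b]"] path_term_length_ge[of \<one> i "[c, d]"]
      by (simp_all add: numeral_2_eq_2)
    have "[a, b] \<in> two_loops i" "[c, d] \<in> two_loops i" using w by (auto simp: two_loops_def)
    then have "loop_sum j (path_term \<one> i [a, b] \<ominus>\<^bsub>A\<^esub> path_term \<one> i [c, d]) = \<zero>" for j
      using len[THEN length_ge_carrier]
      by (simp add: A.minus_eq loop_sum_add loop_sum_a_inv loop_sum_path_term r_neg)
    then show ?thesis using len by (simp add: loop_kernel_def A.minus_eq length_ge_add length_ge_a_inv)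
  qed
  ultimately show ?thesis
    unfolding zigzag_relations_def path_basis_eq by blast
qed

lemma path_term_one_append:
  "path_term \<one> u p \<otimes>\<^bsub>A\<^esub> path_term \<one> (awlast u p) q = path_term \<one> u (p @ q)"
  by (simp add: path_term_mult)

end

section \<open>Zigzag relations of a connected graph\<close>

text \<open>Connectedness refers to the symmetric closure, but a graph is already symmetric, so
  every vertex is reachable from a member of \<open>S\<close> along arcs. With S = {i} this yields a
  neighbour of i, with S = {u, v} a third vertex.\<close>

lemma (in graph) eq_verts_if_arc_closed:
  assumes conn: "Digraph_Component.connected G"
    and S: "S \<subseteq> verts G" "S \<noteq> {}" "\<And>a. a \<in> arcs G \<Longrightarrow> tail G a \<in> S \<Longrightarrow> head G a \<in> S"
  shows "S = verts G"
proof -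
  obtain u where u: "u \<in> S" using S by blast
  have "v \<in> S" if "v \<in> verts G" for v
  proof -
    have "u \<rightarrow>\<^sup>*\<^bsub>mk_symmetric G\<^esub> v"
      using conn u S(1) that by (auto simp: Digraph_Component.connected_def strongly_connected_def)
    then have "u \<rightarrow>\<^sup>* v" by (simp only: reachable_mk_symmetric_eq[OF sym_arcs])
    then show ?thesis
    proof (induction rule: reachable_induct)
      case base
      show ?case by (rule u)
    next
      case (step x y)
      then show ?case using S(3) by (auto simp: arcs_ends_conv)
    qed
  qed
  then show ?thesis using S(1) by blast
qed

lemma (in graph) reverse_arc:
  assumes "a \<in> arcs G"
  obtains b where "b \<in> arcs G" "tail G b = head G a" "head G b = tail G a"
  using sym_arcs assms unfolding symmetric_conv by metis

lemma (in graph) exists_two_loop: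
  assumes "Digraph_Component.connected G" "card (verts G) \<noteq> 1" "i \<in> verts G"
  obtains a b where "awalk i [a, b] i"
proof -
  have "\<exists>a\<in>arcs G. tail G a = i"
  proof (rule ccontr)
    assume "\<not> ?thesis"
    then have "{i} = verts G" using assms by (intro eq_verts_if_arc_closed) auto
    then have "card (verts G) = card {i}" by simp
    then show False using assms(2) by simp
  qed
  then obtain a where a: "a \<in> arcs G" "tail G a = i" by blast
  obtain b where "b \<in> arcs G" "tail G b = head G a" "head G b = tail G a"
    using reverse_arc[OF a(1)] .
  then have "awalk i [a, b] i" using a assms(3) by (simp add: awalk_def)
  then show thesis by (rule that)
qed

text \<open>Otherwise {u, v} would be closed under arcs and the graph would have just these two
  vertices. Here the two-vertex graph parts from the larger ones.\<close>

lemma (in graph) third_vertex_adjacent: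
  assumes "Digraph_Component.connected G" "card (verts G) \<noteq> 2" "u \<in> verts G" "v \<in> verts G" "u \<noteq> v"
  obtains a where "a \<in> arcs G" "tail G a = u \<or> tail G a = v" "head G a \<noteq> u" "head G a \<noteq> v"
proof -
  have "\<exists>a\<in>arcs G. tail G a \<in> {u, v} \<and> head G a \<notin> {u, v}"
  proof (rule ccontr)
    assume "\<not> ?thesis"
    then have "{u, v} = verts G" using assms by (intro eq_verts_if_arc_closed) auto
    then have "card (verts G) = card {u, v}" by simp
    then show False using assms(2,5) by simp
  qed
  then show thesis using that by auto
qed

section \<open>Paths of length three modulo the zigzag relations\<close>

locale graph_algebra = quiver_algebra K G + graph G
  for K :: "('k, 'm) ring_scheme" (structure) and G :: "('a, 'b) pre_digraph"
begin

text \<open>Either the path contains a turn, that is i \<rightarrow> j \<rightarrow> k with i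
  \<noteq> k, which is a relation, or it runs back and forth along one edge. In the second case one
  of its loops is exchanged for a loop through a third vertex, and the new path contains a turn. On
  two vertices there is no such detour, so there the paths of length three have to be imposed as
  relations.\<close>

lemma length_three_path_in_ideal:
  assumes conn: "Digraph_Component.connected G" and card: "card (verts G) \<noteq> 2"
    and I: "ideal I A" and rel: "zigzag_relations K G \<subseteq> I"
    and p: "(u, p) \<in> quiver_paths G" "length p = 3"
  shows "path_term \<one> u p \<in> I"
proof -
  interpret I: ideal I A by (rule I)
  have turn: "path_term \<one> (tail G a) [a, b] \<in> I"
    if "a \<in> arcs G" "b \<in> arcs G" "tail G b = head G a" "tail G a \<noteq> head G b" for a b
  proof -
    have "awalk (tail G a) [a, b] (head G b)" using that by (simp add: awalk_def)
    then show ?thesis using rel that unfolding zigzag_relations_def path_basis_eq by blast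
  qed
  have loop: "path_term \<one> (tail G a) [a, b] \<ominus>\<^bsub>A\<^esub> path_term \<one> (tail G a) [c, d] \<in> I"
    if "a \<in> arcs G" "b \<in> arcs G" "c \<in> arcs G" "d \<in> arcs G" "tail G b = head G a" "head G b = tail G a"
      "tail G c = tail G a" "tail G d = head G c" "head G d = tail G a" for a b c d
  proof -
    have "awalk (tail G a) [a, b] (tail G a)" "awalk (tail G a) [c, d] (tail G a)"
      using that by (simp_all add: awalk_def)
    then show ?thesis using rel unfolding zigzag_relations_def path_basis_eq by blast
  qed
  have arc: "path_term \<one> (tail G a) [a] \<in> carrier A" if "a \<in> arcs G" for a
    using that by (intro path_term_closed) (auto simp: path_iff awalk_def)
  have arc2: "path_term \<one> (tail G a) [a, b] \<in> carrier A"
    if "a \<in> arcs G" "b \<in> arcs G" "tail G b = head G a" for a b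
    using that by (intro path_term_closed) (auto simp: path_iff awalk_def)
  have split12: "path_term \<one> (tail G a) [a, b, c] =
      path_term \<one> (tail G a) [a] \<otimes>\<^bsub>A\<^esub> path_term \<one> (tail G b) [b, c]"
    if "tail G b = head G a" for a b c
    using path_term_one_append[of "tail G a" "[a]" "[b, c]"] that by simp
  have split21: "path_term \<one> (tail G a) [a, b, c] =
      path_term \<one> (tail G a) [a, b] \<otimes>\<^bsub>A\<^esub> path_term \<one> (tail G c) [c]"
    if "tail G c = head G b" for a b c
    using path_term_one_append[of "tail G a" "[a, b]" "[c]"] that by simp
  have three_left: "path_term \<one> (tail G a) [a, b, c] \<in> I"
    if "a \<in> arcs G" "b \<in> arcs G" "c \<in> arcs G" "tail G b = head G a" "tail G c = head G b"
      "tail G a \<noteq> head G b" for a b c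
    unfolding split21[OF that(5)] using that by (intro I.I_r_closed turn arc)
  have three_right: "path_term \<one> (tail G a) [a, b, c] \<in> I"
    if "a \<in> arcs G" "b \<in> arcs G" "c \<in> arcs G" "tail G b = head G a" "tail G c = head G b"
      "tail G b \<noteq> head G c" for a b c
    unfolding split12[OF that(4)] using that by (intro I.I_l_closed turn arc)
  have diff: "x \<in> I" if "x \<ominus>\<^bsub>A\<^esub> y \<in> I" "y \<in> I" "x \<in> carrier A" for x y
  proof -
    have "x = (x \<ominus>\<^bsub>A\<^esub> y) \<oplus>\<^bsub>A\<^esub> y"
      using that I.Icarr by (simp add: A.minus_eq A.a_assoc A.l_neg)
    then show ?thesis using that I.a_closed by metis
  qed
  obtain a b c where pabc: "p = [a, b, c]" using p(2) by (auto simp: length_Suc_conv numeral_3_eq_3)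
  have arcs: "a \<in> arcs G" "b \<in> arcs G" "c \<in> arcs G"
    and u: "u = tail G a" and tb: "tail G b = head G a" and tc: "tail G c = head G b"
    using p(1) by (auto simp: pabc path_iff awalk_def)
  have abc: "path_term \<one> (tail G a) [a, b, c] \<in> carrier A"
    using p by (auto simp: pabc u intro!: path_term_closed)
  have "path_term \<one> (tail G a) [a, b, c] \<in> I"
  proof (cases "tail G a = head G b \<and> tail G b = head G c")
    case False
    then show ?thesis using three_left three_right arcs tb tc by blast
  next
    case True
    have "tail G a \<noteq> head G a" using arcs no_loops by blast
    \<comment> \<open>The path is i \<rightarrow> j \<rightarrow> i \<rightarrow> j. The arc
      \<open>d\<close> leads from i or j to a third vertex k, and \<open>e\<close> leads
      back.\<close>
    then obtain d where d: "d \<in> arcs G" "tail G d = tail G a \<or> tail G d = head G a"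
      "head G d \<noteq> tail G a" "head G d \<noteq> head G a"
      using third_vertex_adjacent[OF conn card, of "tail G a" "head G a"] arcs by auto
    obtain e where e: "e \<in> arcs G" "tail G e = head G d" "head G e = tail G d"
      using reverse_arc[OF d(1)] .
    from d(2) show ?thesis
    proof
      \<comment> \<open>k is a neighbour of i: the first two arcs are exchanged for i \<rightarrow>
        k \<rightarrow> i, and k \<rightarrow> i \<rightarrow> j is a turn as k \<noteq> j.\<close>
      assume td: "tail G d = tail G a"
      have "path_term \<one> (tail G a) [a, b] \<ominus>\<^bsub>A\<^esub> path_term \<one> (tail G a) [d, e] \<in> I"
        using arcs tb True d e td by (intro loop) auto
      then have "(path_term \<one> (tail G a) [a, b] \<ominus>\<^bsub>A\<^esub> path_term \<one> (tail G a) [d, e])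
          \<otimes>\<^bsub>A\<^esub> path_term \<one> (tail G c) [c] \<in> I"
        using arcs by (intro I.I_r_closed arc)
      then have "path_term \<one> (tail G a) [a, b, c] \<ominus>\<^bsub>A\<^esub> path_term \<one> (tail G d) [d, e, c] \<in> I"
        using arc2[of a b] arc2[of d e] arc[of c] arcs tb tc e d td True split21[of c b a] split21[of c e d]
        by (simp add: A.minus_eq A.l_distr A.l_minus)
      moreover have "path_term \<one> (tail G d) [d, e, c] \<in> I"
        using arcs d e td tb tc True by (intro three_right) auto
      ultimately show ?thesis using abc by (rule diff)
    next
      \<comment> \<open>k is a neighbour of j: the last two arcs are exchanged for j \<rightarrow> k
        \<rightarrow> j, and i \<rightarrow> j \<rightarrow> k is a turn as k \<noteq> i.\<close>
      assume td: "tail G d = head G a"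
      have "path_term \<one> (tail G b) [b, c] \<ominus>\<^bsub>A\<^esub> path_term \<one> (tail G b) [d, e] \<in> I"
        using arcs tb tc True d e td by (intro loop) auto
      then have "path_term \<one> (tail G a) [a] \<otimes>\<^bsub>A\<^esub>
          (path_term \<one> (tail G b) [b, c] \<ominus>\<^bsub>A\<^esub> path_term \<one> (tail G b) [d, e]) \<in> I"
        using arcs by (intro I.I_l_closed arc)
      then have "path_term \<one> (tail G a) [a, b, c] \<ominus>\<^bsub>A\<^esub> path_term \<one> (tail G a) [a, d, e] \<in> I"
        using arc2[of b c] arc2[of d e] arc[of a] arcs tb tc e d td True split12[of b a c] split12[of d a e]
        by (simp add: A.minus_eq A.r_distr A.r_minus)
      moreover have "path_term \<one> (tail G a) [a, d, e] \<in> I"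
        using arcs d e td by (intro three_left) auto
      ultimately show ?thesis using abc by (rule diff)
    qed
  qed
  then show ?thesis by (simp add: pabc u)
qed

lemma not_quasi_hereditary_zigzag_algebra:
  assumes K: "field K" and conn: "Digraph_Component.connected G" and card: "card (verts G) \<noteq> 1"
  shows "\<not> quasi_hereditary (zigzag_algebra K G)"
proof -
  have loops: "two_loops i \<noteq> {}" if i: "i \<in> verts G" for i
  proof -
    obtain a b where "awalk i [a, b] i" using exists_two_loop[OF conn card i] .
    then show ?thesis by (auto simp: two_loops_def)
  qed
  note quot = not_quasi_hereditary_path_algebra_quot[OF K inj_Inr loops]
  show ?thesis
  proof (cases "card (verts G) = 2")
    case True
    have "length_three_paths K G \<subseteq> carrier A"
      using path_term_closed by (auto simp: length_three_paths_def path_basis_eq)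
    from quot[OF _ A.genideal_ideal[OF this] Idl_length_three_paths]
    show ?thesis using True by (simp add: zigzag_algebra_def)
  next
    case card2: False
    have rel: "zigzag_relations K G \<subseteq> carrier A"
      using zigzag_relations_subset length_ge_carrier by (auto simp: loop_kernel_def)
    define I where "I = Idl\<^bsub>A\<^esub> (zigzag_relations K G)"
    have I: "ideal I A" unfolding I_def by (rule A.genideal_ideal[OF rel])
    have "zigzag_relations K G \<subseteq> I" unfolding I_def by (rule A.genideal_self[OF rel])
    then have "length_ge 3 \<subseteq> I"
      by (intro length_ge_subset_ideal[OF I] length_three_path_in_ideal[OF conn card2 I])
    moreover have "I \<subseteq> loop_kernel"
      unfolding I_def by (intro A.genideal_minimal ideal_loop_kernel zigzag_relations_subset)
    ultimately have "\<not> quasi_hereditary (image_ring Inr (A Quot I))"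
      by (intro quot I)
    then show ?thesis
      using card card2 by (simp add: zigzag_algebra_def I_def)
  qed
qed

end

theorem theorem2:
  fixes K :: "('k, 'm) ring_scheme" and G :: "('a, 'b) pre_digraph"
  assumes "field K"
    and "graph G"
    and "Digraph_Component.connected G"
  shows "\<not> quasi_hereditary (zigzag_algebra K G)"
proof (cases "card (verts G) = 1")
  case True
  then show ?thesis
    using not_quasi_hereditary_dual_numbers[OF assms(1) inj_Inl] by (simp add: zigzag_algebra_def)
next
  case False
  interpret G: graph G by fact
  have "ring K" using assms(1) by (intro cring.axioms(1) fieldE(1))
  then have "graph_algebra K G"
    by (intro graph_algebra.intro quiver_algebra.intro G.fin_digraph_axioms assms(2))
  then show ?thesis
    using assms(1,3) False by (rule graph_algebra.not_quasi_hereditary_zigzag_algebra)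
qed

end
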